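(* Let $G$ be a countable directed graph with no sinks. Let $T=(T_e)_{e\in E(G)}$ be a row contraction on a Hilbert space $\mathcal{H}$ which is stabilized by a family of projections $\{P'_x:x\in V(G)\}$ on $\mathcal{H}$ (with associated directed graph $G$). Then there is a contractive homomorphism $$\Psi:\mathcal{A}_G\longrightarrow B(\mathcal{H})$$ defined by $\Psi(L_e)=T_e$ and $\Psi(P_x)=P'_x$ for $e\in E(G)$ and $x\in V(G)$.
   Context: $G$ is a countable directed graph with edge set $E(G)$ and vertex set $V(G)$; $s(e)$, $r(e)$ denote the source and range vertices of an edge $e$. $G$ has no sinks if every vertex is the source of some edge. The free semigroupoid $\mathbb{F}^+(G)$ is the set of all vertices and all finite paths $w=e_k\cdots e_1$ of $G$ (with $s(e_{i+1})=r(e_i)$, $s(w)=s(e_1)$, $r(w)=r(e_k)$, and $s(x)=r(x)=x$ for vertices), with concatenation. Row contraction: $T=(T_e)_{e\in E(G)}$ is a family of non-zero bounded operators on $\mathcal{H}$ with $\sum_{e}T_eT_e^*\le I$. Stabilization: $\{P'_x:x\in V(G)\}$ is a family of mutually orthogonal projections on $\mathcal{H}$ which sum to the identity and satisfy $T_eP'_x,\ P'_xT_e\in\{T_e,0\}$ for all $e\in E(G)$, $x\in V(G)$; the associated graph is $G$, meaning $P'_{r(e)}T_eP'_{s(e)}=T_e$ for all $e\in E(G)$. $\mathcal{H}_G$ is the Hilbert space with orthonormal basis $\{\xi_w : w\in\mathbb{F}^+(G)\}$; $L_e\xi_w=\xi_{ew}$ if $r(w)=s(e)$ and $0$ otherwise;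 $P_x$ is the projection of $\mathcal{H}_G$ onto $\overline{\mathrm{span}}\{\xi_w:r(w)=x\}$. The quiver algebra $\mathcal{A}_G$ is the norm-closed algebra generated by $\{L_e,P_x: e\in E(G),x\in V(G)\}$. *)

theory Defs
  imports "HOL-Analysis.Analysis" "Graph_Theory.Digraph"
begin

section \<open>Complex Hilbert spaces\<close>

class scaleC = scaleR +
  fixes scaleC :: "complex \<Rightarrow> 'a \<Rightarrow> 'a" (infixr \<open>*\<^sub>C\<close> 75)
  assumes scaleR_scaleC: "scaleR r x = scaleC (complex_of_real r) x"

class complex_normed_vector = scaleC + real_normed_vector +
  assumes scaleC_add_right: "a *\<^sub>C (x + y) = a *\<^sub>C x + a *\<^sub>C y"
    and scaleC_add_left: "(a + b) *\<^sub>C x = a *\<^sub>C x + b *\<^sub>C x"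
    and scaleC_scaleC: "a *\<^sub>C b *\<^sub>C x = (a * b) *\<^sub>C x"
    and scaleC_one: "1 *\<^sub>C x = x"
    and norm_scaleC: "norm (a *\<^sub>C x) = cmod a * norm x"

global_interpretation complex_vector: vector_space
  "scaleC :: complex \<Rightarrow> 'a \<Rightarrow> 'a :: complex_normed_vector"
  defines cspan = complex_vector.span
  by unfold_locales (simp_all add: scaleC_add_right scaleC_add_left scaleC_scaleC scaleC_one)

text \<open>
  The complex inner product is linear in the first argument. The underlying real Hilbert
  space carries the real part of it as its inner product; in particular
  \<open>norm x = sqrt (Re (cinner x x))\<close>, and positivity is inherited from \<open>real_inner\<close>.
\<close>

class chilbert_space = complex_normed_vector + real_inner + complete_space +
  fixes cinner :: "'a \<Rightarrow> 'a \<Rightarrow> complex"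
  assumes cinner_commute: "cinner x y = cnj (cinner y x)"
    and cinner_add_left: "cinner (x + y) z = cinner x z + cinner y z"
    and cinner_scaleC_left: "cinner (a *\<^sub>C x) y = a * cinner x y"
    and Re_cinner: "Re (cinner x y) = inner x y"

instantiation complex :: chilbert_space
begin

definition scaleC_complex :: "complex \<Rightarrow> complex \<Rightarrow> complex" where
  "scaleC_complex a x = a * x"

definition cinner_complex :: "complex \<Rightarrow> complex \<Rightarrow> complex" where
  "cinner_complex x y = x * cnj y"

instance
  by standard
    (auto simp: scaleC_complex_def cinner_complex_def scaleR_conv_of_real norm_mult
       algebra_simps inner_complex_def)

end


section \<open>Bounded operators\<close>

text \<open>
  The type \<open>'a \<Rightarrow>\<^sub>L 'b\<close> consists of the bounded real-linear maps, with the operator norm.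
  The bounded operators in the complex sense are the elements of \<open>cbounded\<close>.
\<close>

instantiation blinfun :: (real_normed_vector, complex_normed_vector) complex_normed_vector
begin

lift_definition scaleC_blinfun :: "complex \<Rightarrow> 'a \<Rightarrow>\<^sub>L 'b \<Rightarrow> 'a \<Rightarrow>\<^sub>L 'b"
  is "\<lambda>c f x. c *\<^sub>C f x"
proof -
  fix c :: complex and f :: "'a \<Rightarrow> 'b"
  assume "bounded_linear f"
  then interpret f: bounded_linear f .
  show "bounded_linear (\<lambda>x. c *\<^sub>C f x)"
  proof (rule bounded_linear_intro[where K = "cmod c * onorm f"])
    show "c *\<^sub>C f (x + y) = c *\<^sub>C f x + c *\<^sub>C f y" for x y
      by (simp add: f.add scaleC_add_right)
    show "c *\<^sub>C f (r *\<^sub>R x) = r *\<^sub>R c *\<^sub>C f x" for r x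
      by (simp add: f.scaleR scaleR_scaleC scaleC_scaleC mult.commute)
    show "norm (c *\<^sub>C f x) \<le> norm x * (cmod c * onorm f)" for x
      using mult_left_mono[OF onorm[OF f.bounded_linear_axioms, of x] norm_ge_zero[of c]]
      by (simp add: norm_scaleC mult_ac)
  qed
qed

instance
proof
  fix r :: real and a b :: complex and f g :: "'a \<Rightarrow>\<^sub>L 'b"
  show "r *\<^sub>R f = complex_of_real r *\<^sub>C f"
    by transfer (simp add: scaleR_scaleC)
  show "a *\<^sub>C (f + g) = a *\<^sub>C f + a *\<^sub>C g"
    by transfer (simp add: scaleC_add_right)
  show "(a + b) *\<^sub>C f = a *\<^sub>C f + b *\<^sub>C f"
    by transfer (simp add: scaleC_add_left)
  show "a *\<^sub>C b *\<^sub>C f = (a * b) *\<^sub>C f"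
    by transfer (simp add: scaleC_scaleC)
  show "1 *\<^sub>C f = f"
    by transfer (simp add: scaleC_one)
  show "norm (a *\<^sub>C f) = cmod a * norm f"
  proof transfer
    fix a :: complex and f :: "'a \<Rightarrow> 'b"
    assume f: "bounded_linear f"
    have "onorm (\<lambda>x. a *\<^sub>C f x) = onorm (\<lambda>x. cmod a *\<^sub>R f x)"
      unfolding onorm_def by (simp add: norm_scaleC)
    then show "onorm (\<lambda>x. a *\<^sub>C f x) = cmod a * onorm f"
      using onorm_scaleR[OF f, of "cmod a"] by simp
  qed
qed

end

definition cbounded :: "('a::complex_normed_vector \<Rightarrow>\<^sub>L 'b::complex_normed_vector) set" where
  "cbounded = {A :: 'a \<Rightarrow>\<^sub>L 'b. \<forall>c x. A (c *\<^sub>C x) = c *\<^sub>C A x}"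

definition adj :: "('a::chilbert_space \<Rightarrow>\<^sub>L 'a) \<Rightarrow> 'a \<Rightarrow>\<^sub>L 'a" where
  "adj A = (THE B :: 'a \<Rightarrow>\<^sub>L 'a. \<forall>x y. cinner (A x) y = cinner x (B y))"

definition op_le :: "('a::chilbert_space \<Rightarrow>\<^sub>L 'a) \<Rightarrow> ('a \<Rightarrow>\<^sub>L 'a) \<Rightarrow> bool" where
  "op_le A B \<longleftrightarrow> (\<forall>x. cinner ((B - A) x) x \<in> \<real> \<and> 0 \<le> Re (cinner ((B - A) x) x))"

text \<open>Unconditional convergence of an operator sum in the strong operator topology.\<close>

definition has_strong_sum ::
    "('i \<Rightarrow> 'a::chilbert_space \<Rightarrow>\<^sub>L 'a) \<Rightarrow> ('a \<Rightarrow>\<^sub>L 'a) \<Rightarrow> 'i set \<Rightarrow> bool" where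
  "has_strong_sum A S I \<longleftrightarrow> (\<forall>x. ((\<lambda>i. A i x) has_sum S x) I)"

definition is_projection :: "('a::chilbert_space \<Rightarrow>\<^sub>L 'a) \<Rightarrow> bool" where
  "is_projection P \<longleftrightarrow> P \<in> cbounded \<and> P o\<^sub>L P = P \<and> adj P = P"

text \<open>The orthogonal projection onto a closed complex-linear subspace.\<close>

definition projection_onto :: "'a::chilbert_space set \<Rightarrow> 'a \<Rightarrow>\<^sub>L 'a" where
  "projection_onto M = (THE P :: 'a \<Rightarrow>\<^sub>L 'a. \<forall>x. P x \<in> M \<and> (\<forall>y\<in>M. cinner (x - P x) y = 0))"

definition orthonormal_basis :: "'i set \<Rightarrow> ('i \<Rightarrow> 'a::chilbert_space) \<Rightarrow> bool" where
  "orthonormal_basis I b \<longleftrightarrow>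
     (\<forall>i\<in>I. \<forall>j\<in>I. cinner (b i) (b j) = (if i = j then 1 else 0)) \<and>
     closure (cspan (b ` I)) = UNIV"

text \<open>Subalgebras are not required to contain the identity.\<close>

definition subalgebra :: "('a::chilbert_space \<Rightarrow>\<^sub>L 'a) set \<Rightarrow> bool" where
  "subalgebra X \<longleftrightarrow> 0 \<in> X \<and> (\<forall>A\<in>X. \<forall>B\<in>X. A + B \<in> X) \<and>
     (\<forall>c. \<forall>A\<in>X. c *\<^sub>C A \<in> X) \<and> (\<forall>A\<in>X. \<forall>B\<in>X. A o\<^sub>L B \<in> X)"

definition algebra_hom :: "('a::chilbert_space \<Rightarrow>\<^sub>L 'a) set \<Rightarrow>
    (('a \<Rightarrow>\<^sub>L 'a) \<Rightarrow> ('b::chilbert_space \<Rightarrow>\<^sub>L 'b)) \<Rightarrow> bool" where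
  "algebra_hom X \<Psi> \<longleftrightarrow> (\<forall>A\<in>X. \<Psi> A \<in> cbounded) \<and>
     (\<forall>A\<in>X. \<forall>B\<in>X. \<Psi> (A + B) = \<Psi> A + \<Psi> B) \<and>
     (\<forall>c. \<forall>A\<in>X. \<Psi> (c *\<^sub>C A) = c *\<^sub>C \<Psi> A) \<and>
     (\<forall>A\<in>X. \<forall>B\<in>X. \<Psi> (A o\<^sub>L B) = \<Psi> A o\<^sub>L \<Psi> B)"


section \<open>The free semigroupoid of a directed graph\<close>

text \<open>
  The source of an edge is its \<open>tail\<close>, the range is its \<open>head\<close>. The path
  \<open>e\<^sub>k \<dots> e\<^sub>1\<close> is \<open>Path [e\<^sub>k, \<dots>, e\<^sub>1]\<close>, so that the edge traversed first comes last.
\<close>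

definition no_sinks :: "('v, 'e) pre_digraph \<Rightarrow> bool" where
  "no_sinks G \<longleftrightarrow> (\<forall>x\<in>verts G. \<exists>e\<in>arcs G. tail G e = x)"

datatype ('v, 'e) word = Vertex 'v | Path "'e list"

fun src :: "('v, 'e) pre_digraph \<Rightarrow> ('v, 'e) word \<Rightarrow> 'v" where
  "src G (Vertex x) = x"
| "src G (Path es) = tail G (last es)"

fun rng :: "('v, 'e) pre_digraph \<Rightarrow> ('v, 'e) word \<Rightarrow> 'v" where
  "rng G (Vertex x) = x"
| "rng G (Path es) = head G (hd es)"

text \<open>Only meaningful for \<open>src G v = rng G w\<close>.\<close>

fun concat_word :: "('v, 'e) word \<Rightarrow> ('v, 'e) word \<Rightarrow> ('v, 'e) word" where
  "concat_word (Vertex x) w = w"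
| "concat_word v (Vertex x) = v"
| "concat_word (Path es) (Path fs) = Path (es @ fs)"

definition free_semigroupoid :: "('v, 'e) pre_digraph \<Rightarrow> ('v, 'e) word set" where
  "free_semigroupoid G = Vertex ` verts G \<union>
     {Path es | es. es \<noteq> [] \<and> set es \<subseteq> arcs G \<and> successively (\<lambda>f e. tail G f = head G e) es}"


section \<open>The quiver algebra\<close>

text \<open>
  The Hilbert space of \<open>G\<close> is given by an orthonormal basis \<open>\<xi>\<close> indexed by
  \<open>free_semigroupoid G\<close>; the values of \<open>\<xi>\<close> outside this set are irrelevant.
\<close>

definition creation :: "('v, 'e) pre_digraph \<Rightarrow> (('v, 'e) word \<Rightarrow> 'k::chilbert_space) \<Rightarrow>
    'e \<Rightarrow> 'k \<Rightarrow>\<^sub>L 'k" where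
  "creation G \<xi> e = (THE L :: 'k \<Rightarrow>\<^sub>L 'k. L \<in> cbounded \<and> (\<forall>w\<in>free_semigroupoid G.
     L (\<xi> w) = (if rng G w = tail G e then \<xi> (concat_word (Path [e]) w) else 0)))"

definition vertex_projection :: "('v, 'e) pre_digraph \<Rightarrow>
    (('v, 'e) word \<Rightarrow> 'k::chilbert_space) \<Rightarrow> 'v \<Rightarrow> 'k \<Rightarrow>\<^sub>L 'k" where
  "vertex_projection G \<xi> x =
     projection_onto (closure (cspan (\<xi> ` {w \<in> free_semigroupoid G. rng G w = x})))"

definition quiver_algebra :: "('v, 'e) pre_digraph \<Rightarrow>
    (('v, 'e) word \<Rightarrow> 'k::chilbert_space) \<Rightarrow> ('k \<Rightarrow>\<^sub>L 'k) set" where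
  "quiver_algebra G \<xi> = (\<lambda>X. subalgebra X \<and> closed X) hull
     (creation G \<xi> ` arcs G \<union> vertex_projection G \<xi> ` verts G)"


section \<open>Stabilized row contractions\<close>

definition row_contraction :: "'e set \<Rightarrow> ('e \<Rightarrow> 'h::chilbert_space \<Rightarrow>\<^sub>L 'h) \<Rightarrow> bool" where
  "row_contraction E T \<longleftrightarrow> (\<forall>e\<in>E. T e \<in> cbounded \<and> T e \<noteq> 0) \<and>
     (\<exists>S. has_strong_sum (\<lambda>e. T e o\<^sub>L adj (T e)) S E \<and> op_le S id_blinfun)"

definition stabilizes :: "('v, 'e) pre_digraph \<Rightarrow> ('v \<Rightarrow> 'h::chilbert_space \<Rightarrow>\<^sub>L 'h) \<Rightarrow>
    ('e \<Rightarrow> 'h \<Rightarrow>\<^sub>L 'h) \<Rightarrow> bool" where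
  "stabilizes G Q T \<longleftrightarrow>
     (\<forall>x\<in>verts G. is_projection (Q x)) \<and>
     (\<forall>x\<in>verts G. \<forall>y\<in>verts G. x \<noteq> y \<longrightarrow> Q x o\<^sub>L Q y = 0) \<and>
     has_strong_sum Q id_blinfun (verts G) \<and>
     (\<forall>e\<in>arcs G. \<forall>x\<in>verts G. T e o\<^sub>L Q x \<in> {T e, 0} \<and> Q x o\<^sub>L T e \<in> {T e, 0}) \<and>
     (\<forall>e\<in>arcs G. Q (head G e) o\<^sub>L T e o\<^sub>L Q (tail G e) = T e)"

end

theory Submission
  imports Defs
begin

text \<open>
  The homomorphism is polynomial evaluation \<open>p(L, P) \<mapsto> p(T, Q)\<close>, and the content of the theorem is the
  von Neumann inequality \<open>\<parallel>p(T, Q)\<parallel> \<le> \<parallel>p(L, P)\<parallel>\<close>. It is enough to prove it for \<open>S = r T\<close> with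
  \<open>0 < r < 1\<close> and to let \<open>r\<close> tend to 1.

  For a path \<open>w\<close> let \<open>S\<^sub>w\<close> be the corresponding product of operators, with \<open>S\<^sub>x = Q\<^sub>x\<close> for a vertex
  \<open>x\<close>, and let \<open>D = I - (\<Sum>e. S\<^sub>e S\<^sub>e\<^sup>*)\<close>. Peeling off one edge after the other gives the Poisson
  identity \<open>\<parallel>g\<parallel>\<^sup>2 = (\<Sum>w. \<langle>D S\<^sub>w\<^sup>* g, S\<^sub>w\<^sup>* g\<rangle>)\<close> (\<open>poisson_words\<close>): \<open>g \<mapsto> (D\<^sup>1\<^sup>/\<^sup>2 S\<^sub>w\<^sup>* g)\<^sub>w\<close> is an
  isometry into the tensor product of the path space with the given Hilbert space, and it
  intertwines \<open>B\<^sup>*\<close> with \<open>A\<^sup>* \<otimes> I\<close> whenever \<open>A = p(L, P)\<close> and \<open>B = p(S, Q)\<close>. Hence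
  \<open>\<parallel>B\<^sup>* h\<parallel> \<le> \<parallel>A\<parallel> \<parallel>h\<parallel>\<close>.

  Neither the tensor product nor the square root of \<open>D\<close> is constructed. The inequality
  \<open>\<parallel>A \<otimes> I\<parallel> \<le> \<parallel>A\<parallel>\<close> is used only for finite matrices and the semi-inner product of \<open>D\<close>, where it is an
  instance of Schur's product theorem (\<open>amplification_bound\<close>). Strictness of \<open>S\<close> provides a
  bounded linear map \<open>V\<close> from the path space to operators with \<open>V \<xi>\<^sub>w = S\<^sub>w\<close> (\<open>symbol_exists\<close>), and
  the relation between \<open>A\<close> and \<open>B\<close> is expressed as \<open>B V(k) = V(A k)\<close> for all \<open>k\<close>. This relation
  contains the pairs of generators, is compatible with the algebra operations, and is contractive
  (\<open>intertwined_contractive\<close>).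

  The relations for the various \<open>r\<close> have a limit as \<open>r\<close> tends to 1, and its closure is the graph of
  the desired homomorphism on an algebra that contains the quiver algebra.
\<close>

section \<open>Complex inner products and adjoints\<close>

instance chilbert_space \<subseteq> banach ..

lemma cinner_add_right: "cinner x (y + z) = cinner x y + cinner x z"
  by (metis cinner_commute cinner_add_left complex_cnj_add)

lemma cinner_scaleC_right: "cinner x (a *\<^sub>C y) = cnj a * cinner x y"
  by (metis cinner_commute cinner_scaleC_left complex_cnj_mult)

lemma Im_cinner_self: "Im (cinner x x) = 0"
  using arg_cong[OF cinner_commute[of x x], of Im] by simp

lemma cinner_self: "cinner x x = complex_of_real ((norm x)\<^sup>2)"
  by (rule complex_eqI) (simp_all add: Re_cinner Im_cinner_self power2_norm_eq_inner)

text \<open>Rotating \<open>x\<close> by a unit scalar makes the inner product real; then the real inequality applies.\<close>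

lemma norm_cinner_le: "cmod (cinner x y) \<le> norm x * norm y"
proof (cases "cinner x y = 0")
  case False
  define c where "c = cnj (cinner x y) / cmod (cinner x y)"
  have "cmod c = 1"
    using False by (simp add: c_def norm_divide)
  have "complex_of_real (cmod (cinner x y)) = c * cinner x y"
    using False by (simp add: c_def complex_norm_square[symmetric] power2_eq_square mult.commute)
  then have "cmod (cinner x y) = Re (cinner (c *\<^sub>C x) y)"
    unfolding cinner_scaleC_left by (metis Re_complex_of_real)
  also have "\<dots> \<le> norm (c *\<^sub>C x) * norm y"
    by (simp add: Re_cinner norm_cauchy_schwarz)
  finally show ?thesis
    using \<open>cmod c = 1\<close> by (simp add: norm_scaleC)
qed simp

lemma bounded_bilinear_cinner: "bounded_bilinear (cinner :: 'a::chilbert_space \<Rightarrow> 'a \<Rightarrow> complex)"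
  by (rule bounded_bilinear.intro)
    (auto simp: cinner_add_left cinner_add_right scaleR_scaleC cinner_scaleC_left
      cinner_scaleC_right scaleC_complex_def scaleR_conv_of_real intro!: exI[of _ 1] norm_cinner_le)

interpretation cinner: bounded_bilinear "cinner :: 'a::chilbert_space \<Rightarrow> 'a \<Rightarrow> complex"
  by (rule bounded_bilinear_cinner)

lemma bounded_linear_scaleC: "bounded_linear (\<lambda>x::'a::complex_normed_vector. c *\<^sub>C x)"
  by (rule bounded_linear_intro[of _ "cmod c"])
    (simp_all add: scaleC_add_right scaleR_scaleC scaleC_scaleC norm_scaleC mult.commute)

lemma vector_eqI_inner:
  assumes "\<And>x. inner x y = inner x z"
  shows "y = (z::'a::chilbert_space)"
proof -
  have "inner (y - z) (y - z) = 0"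
    using assms[of "y - z"] by (simp add: inner_diff_right)
  then show ?thesis by simp
qed

text \<open>
  The representing vector minimises \<open>\<parallel>x\<parallel>\<^sup>2 / 2 - f x\<close>; by the parallelogram law a minimising
  sequence is Cauchy, and the first-order condition at the minimum is the representation.
\<close>

lemma riesz_representation:
  fixes f :: "'a::{real_inner, complete_space} \<Rightarrow> real"
  assumes "bounded_linear f"
  shows "\<exists>z. \<forall>x. f x = inner z x"
proof -
  interpret f: bounded_linear f by fact
  define \<phi> where "\<phi> x = (norm x)\<^sup>2 / 2 - f x" for x
  obtain K where K: "\<And>x. \<bar>f x\<bar> \<le> norm x * K"
    using f.bounded by auto
  have low: "\<phi> x \<ge> - K\<^sup>2 / 2" for x
  proof -
    have "0 \<le> (norm x - K)\<^sup>2" by simp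
    then show ?thesis
      using K[of x] by (simp add: \<phi>_def power2_diff field_simps)
  qed
  define m where "m = (INF x. \<phi> x)"
  have bdd: "bdd_below (range \<phi>)"
    using low by (auto intro!: bdd_belowI)
  have m_le: "m \<le> \<phi> x" for x
    unfolding m_def by (rule cINF_lower[OF bdd]) simp
  have "\<exists>x. \<phi> x < m + 1 / (real n + 1)" for n :: nat
  proof -
    have "m < m + 1 / (real n + 1)" by simp
    then show ?thesis
      unfolding m_def by (subst (asm) cINF_less_iff[OF _ bdd]) auto
  qed
  then obtain X where X: "\<And>n::nat. \<phi> (X n) < m + 1 / (real n + 1)"
    by metis
  have para: "(norm (x - y))\<^sup>2 / 4 \<le> \<phi> x + \<phi> y - 2 * m" for x y
  proof -
    have "(norm (x - y))\<^sup>2 / 4 = \<phi> x + \<phi> y - 2 * \<phi> ((1/2) *\<^sub>R (x + y))"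
      unfolding \<phi>_def f.scaleR f.add power2_norm_eq_inner
      by (simp add: inner_add_left inner_add_right inner_diff_left inner_diff_right
          inner_commute field_simps)
    then show ?thesis using m_le[of "(1/2) *\<^sub>R (x + y)"] by simp
  qed
  have "Cauchy X"
  proof (rule metric_CauchyI)
    fix e :: real assume "e > 0"
    obtain N :: nat where N: "8 / e\<^sup>2 < real N"
      using reals_Archimedean2 by blast
    have "dist (X i) (X j) < e" if "i \<ge> N" "j \<ge> N" for i j
    proof -
      have "1 / (real k + 1) < e\<^sup>2 / 8" if "k \<ge> N" for k
      proof -
        have "8 / e\<^sup>2 < real k + 1" using N that by linarith
        then show ?thesis using \<open>e > 0\<close> by (simp add: field_simps)
      qed
      from this[OF that(1)] this[OF that(2)] have "(norm (X i - X j))\<^sup>2 / 4 < e\<^sup>2 / 4"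
        using para[of "X i" "X j"] X[of i] X[of j] by linarith
      then show ?thesis
        using \<open>e > 0\<close> by (simp add: dist_norm power2_less_imp_less)
    qed
    then show "\<exists>N. \<forall>i\<ge>N. \<forall>j\<ge>N. dist (X i) (X j) < e" by blast
  qed
  then obtain z where z: "X \<longlonglongrightarrow> z"
    by (metis Cauchy_convergent convergent_def)
  have "(\<lambda>n. \<phi> (X n)) \<longlonglongrightarrow> \<phi> z"
    unfolding \<phi>_def by (intro tendsto_intros z f.tendsto) simp
  moreover have "(\<lambda>n. m + 1 / (real n + 1)) \<longlonglongrightarrow> m + 0"
    by (intro tendsto_intros) (use LIMSEQ_inverse_real_of_nat in \<open>simp add: field_simps\<close>)
  ultimately have "\<phi> z \<le> m + 0"
    by (rule LIMSEQ_le) (use X in \<open>auto intro: less_imp_le\<close>)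
  then have min: "\<phi> z \<le> \<phi> x" for x
    using m_le[of x] by simp
  have "f x = inner z x" for x
  proof (rule ccontr)
    assume ne: "f x \<noteq> inner z x"
    define d where "d = inner z x - f x"
    define q where "q = (norm x)\<^sup>2 + 1"
    define t where "t = - d / q"
    have p: "q > 0" by (simp add: q_def add_nonneg_pos)
    have "\<phi> (z + t *\<^sub>R x) = \<phi> z + t * d + t\<^sup>2 * (norm x)\<^sup>2 / 2"
      unfolding \<phi>_def f.scaleR f.add d_def power2_norm_eq_inner
      by (simp add: inner_add_left inner_add_right inner_commute field_simps power2_eq_square)
    with min[of "z + t *\<^sub>R x"] have "0 \<le> t * d + t\<^sup>2 * (norm x)\<^sup>2 / 2" by simp
    also have "\<dots> \<le> t * d + t\<^sup>2 * q / 2"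
      by (simp add: mult_left_mono q_def)
    also have "\<dots> = - d\<^sup>2 / (2 * q)"
      using p by (simp add: t_def field_simps power2_eq_square)
    finally have "d\<^sup>2 \<le> 0"
      using p by (simp add: field_simps zero_le_mult_iff)
    then show False using ne by (simp add: d_def)
  qed
  then show ?thesis by blast
qed

lemma zero_in_cbounded: "0 \<in> cbounded"
  by (simp add: cbounded_def complex_vector.scale_zero_right)

lemma cbounded_add: "A \<in> cbounded \<Longrightarrow> B \<in> cbounded \<Longrightarrow> A + B \<in> cbounded"
  by (simp add: cbounded_def blinfun.add_left scaleC_add_right)

lemma cbounded_scaleC: "A \<in> cbounded \<Longrightarrow> c *\<^sub>C A \<in> cbounded"
  by (simp add: cbounded_def scaleC_blinfun.rep_eq scaleC_scaleC mult.commute)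

lemma cbounded_diff: "A \<in> cbounded \<Longrightarrow> B \<in> cbounded \<Longrightarrow> A - B \<in> cbounded"
  by (simp add: cbounded_def blinfun.diff_left complex_vector.scale_right_diff_distrib)

lemma cbounded_compose: "A \<in> cbounded \<Longrightarrow> B \<in> cbounded \<Longrightarrow> A o\<^sub>L B \<in> cbounded"
  by (simp add: cbounded_def)

lemma cbounded_sum: "(\<And>i. i \<in> F \<Longrightarrow> A i \<in> cbounded) \<Longrightarrow> sum A F \<in> cbounded"
  by (induction F rule: infinite_finite_induct) (simp_all add: zero_in_cbounded cbounded_add)

lemma closed_cbounded:
  "closed (cbounded :: ('a::complex_normed_vector \<Rightarrow>\<^sub>L 'b::complex_normed_vector) set)"
proof -
  have eq: "cbounded = (\<Inter>c. \<Inter>x. {A :: 'a \<Rightarrow>\<^sub>L 'b. A (c *\<^sub>C x) = c *\<^sub>C A x})"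
    by (auto simp: cbounded_def)
  show ?thesis
    unfolding eq
    by (intro closed_INT ballI closed_Collect_eq continuous_intros
        bounded_linear.continuous_on[OF bounded_linear_scaleC])
qed

lemma cbounded_apply: "A \<in> cbounded \<Longrightarrow> A (c *\<^sub>C x) = c *\<^sub>C A x"
  by (simp add: cbounded_def)

text \<open>The imaginary part of \<open>cinner x y\<close> is the real part of \<open>cinner (- \<i> *\<^sub>C x) y\<close>.\<close>

lemma cinner_eqI_inner:
  assumes "\<And>c. inner (c *\<^sub>C x) y = inner (c *\<^sub>C x') y'"
  shows "cinner x y = cinner x' y'"
proof (rule complex_eqI)
  show "Re (cinner x y) = Re (cinner x' y')"
    using assms[of 1] by (simp add: Re_cinner scaleC_one)
  have "Re (cinner ((-\<i>) *\<^sub>C x) y) = Re (cinner ((-\<i>) *\<^sub>C x') y')"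
    using assms by (simp only: Re_cinner)
  then show "Im (cinner x y) = Im (cinner x' y')"
    by (simp add: cinner_scaleC_left cinner.minus_left)
qed

lemma adjoint_exists:
  fixes A :: "'a::chilbert_space \<Rightarrow>\<^sub>L 'a"
  assumes "A \<in> cbounded"
  shows "\<exists>B :: 'a \<Rightarrow>\<^sub>L 'a. \<forall>x y. cinner (A x) y = cinner x (B y)"
proof -
  have "\<exists>z. \<forall>x. inner (A x) y = inner z x" for y
    by (rule riesz_representation)
      (intro bounded_linear_intros blinfun.bounded_linear_right)
  then obtain B where B: "\<And>x y. inner (A x) y = inner x (B y)"
    by (metis inner_commute)
  have "bounded_linear B"
  proof (rule bounded_linear_intro[of _ "norm A"])
    show "B (x + y) = B x + B y" for x y
      by (rule vector_eqI_inner) (simp add: B[symmetric] inner_add_right)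
    show "B (r *\<^sub>R x) = r *\<^sub>R B x" for r x
      by (rule vector_eqI_inner) (simp add: B[symmetric])
    show "norm (B y) \<le> norm y * norm A" for y
    proof (cases "B y = 0")
      case False
      have "norm (B y) * norm (B y) = inner (A (B y)) y"
        by (simp add: B power2_norm_eq_inner[symmetric] power2_eq_square)
      also have "\<dots> \<le> norm (A (B y)) * norm y"
        by (rule norm_cauchy_schwarz)
      also have "\<dots> \<le> (norm A * norm (B y)) * norm y"
        by (intro mult_right_mono norm_blinfun) simp
      finally show ?thesis
        using False by (simp add: mult_ac)
    qed simp
  qed
  then have "cinner (A x) y = cinner x (Blinfun B y)" for x y
    by (intro cinner_eqI_inner)
      (simp add: bounded_linear_Blinfun_apply B cbounded_apply[OF assms, symmetric])
  then show ?thesis by blast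
qed

lemma adj_eqI:
  fixes A B :: "'a::chilbert_space \<Rightarrow>\<^sub>L 'a"
  assumes "\<And>x y. cinner (A x) y = cinner x (B y)"
  shows "adj A = B"
  unfolding adj_def
proof (rule the_equality)
  fix C :: "'a \<Rightarrow>\<^sub>L 'a" assume "\<forall>x y. cinner (A x) y = cinner x (C y)"
  then have "cinner x (C y) = cinner x (B y)" for x y
    using assms by simp
  then have "inner x (C y) = inner x (B y)" for x y
    by (simp flip: Re_cinner)
  then show "C = B"
    by (intro blinfun_eqI vector_eqI_inner)
qed (use assms in blast)

lemma cinner_adj_right: "A \<in> cbounded \<Longrightarrow> cinner x (adj A y) = cinner (A x) y"
  using adjoint_exists[of A] adj_eqI[of A] by metis

lemma cinner_adj_left: "A \<in> cbounded \<Longrightarrow> cinner (adj A x) y = cinner x (A y)"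
  using cinner_adj_right[of A y x] by (metis cinner_commute)

lemma adj_add: "A \<in> cbounded \<Longrightarrow> B \<in> cbounded \<Longrightarrow> adj (A + B) = adj A + adj B"
  by (rule adj_eqI) (simp add: blinfun.add_left cinner_add_left cinner_add_right cinner_adj_right)

lemma adj_diff: "A \<in> cbounded \<Longrightarrow> B \<in> cbounded \<Longrightarrow> adj (A - B) = adj A - adj B"
  by (rule adj_eqI) (simp add: blinfun.diff_left cinner.diff_left cinner.diff_right cinner_adj_right)

lemma adj_scaleC: "A \<in> cbounded \<Longrightarrow> adj (c *\<^sub>C A) = cnj c *\<^sub>C adj A"
  by (rule adj_eqI)
    (simp add: scaleC_blinfun.rep_eq cinner_scaleC_left cinner_scaleC_right cinner_adj_right)

lemma adj_zero: "adj 0 = 0"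
  by (rule adj_eqI) (simp add: cinner.zero_left cinner.zero_right)

lemma adj_compose: "A \<in> cbounded \<Longrightarrow> B \<in> cbounded \<Longrightarrow> adj (A o\<^sub>L B) = adj B o\<^sub>L adj A"
  by (rule adj_eqI) (simp add: cinner_adj_right)

lemma adj_sum: "(\<And>i. i \<in> F \<Longrightarrow> A i \<in> cbounded) \<Longrightarrow> adj (sum A F) = (\<Sum>i\<in>F. adj (A i))"
  by (induction F rule: infinite_finite_induct) (simp_all add: adj_zero adj_add cbounded_sum)

lemma norm_adj_apply_le:
  assumes "A \<in> cbounded"
  shows "norm (adj A y) \<le> norm A * norm y"
proof (cases "adj A y = 0")
  case False
  have "norm (adj A y) * norm (adj A y) = cmod (cinner (adj A y) (adj A y))"
    by (simp add: cinner_self power2_eq_square norm_mult)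
  also have "\<dots> = cmod (cinner (A (adj A y)) y)"
    using assms by (simp only: cinner_adj_right)
  also have "\<dots> \<le> norm (A (adj A y)) * norm y"
    by (rule norm_cinner_le)
  also have "\<dots> \<le> (norm A * norm (adj A y)) * norm y"
    by (intro mult_right_mono norm_blinfun) simp
  finally show ?thesis
    using False by (simp add: mult_ac)
qed simp

lemma norm_le_of_adj_apply_le:
  assumes "A \<in> cbounded" "C \<ge> 0" "\<And>y. norm (adj A y) \<le> C * norm y"
  shows "norm A \<le> C"
proof (rule norm_blinfun_bound[OF assms(2)])
  fix x show "norm (A x) \<le> C * norm x"
  proof (cases "A x = 0")
    case False
    have "norm (A x) * norm (A x) = cmod (cinner (A x) (A x))"
      by (simp add: cinner_self power2_eq_square norm_mult)
    also have "\<dots> = cmod (cinner x (adj A (A x)))"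
      using assms(1) by (simp only: cinner_adj_right)
    also have "\<dots> \<le> norm x * norm (adj A (A x))"
      by (rule norm_cinner_le)
    also have "\<dots> \<le> norm x * (C * norm (A x))"
      by (intro mult_left_mono assms(3)) simp
    finally show ?thesis
      using False by (simp add: mult_ac)
  qed (use assms(2) in simp)
qed

section \<open>Orthonormal families\<close>

lemma cinner_sum_self:
  assumes "finite F"
    and "\<And>i j. i \<in> F \<Longrightarrow> j \<in> F \<Longrightarrow> cinner (b i) (b j) = (if i = j then 1 else 0)"
  shows "cinner (\<Sum>i\<in>F. c i *\<^sub>C b i) (\<Sum>j\<in>F. d j *\<^sub>C b j) = (\<Sum>i\<in>F. c i * cnj (d i))"
proof -
  have "(\<Sum>i\<in>F. c i * cinner (b i) (b j)) = c j" if "j \<in> F" for j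
  proof -
    have "(\<Sum>i\<in>F. c i * cinner (b i) (b j)) = (\<Sum>i\<in>F. if i = j then c i else 0)"
      using that assms(2) by (intro sum.cong) auto
    then show ?thesis
      using that assms(1) by simp
  qed
  then show ?thesis
    by (simp add: cinner.sum_left cinner.sum_right cinner_scaleC_left cinner_scaleC_right mult.commute)
qed

lemma norm_orthonormal_sum:
  assumes "finite F"
    and "\<And>i j. i \<in> F \<Longrightarrow> j \<in> F \<Longrightarrow> cinner (b i) (b j) = (if i = j then 1 else 0)"
  shows "(norm (\<Sum>i\<in>F. c i *\<^sub>C b i))\<^sup>2 = (\<Sum>i\<in>F. (cmod (c i))\<^sup>2)"
proof -
  have "complex_of_real ((norm (\<Sum>i\<in>F. c i *\<^sub>C b i))\<^sup>2) = (\<Sum>i\<in>F. c i * cnj (c i))"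
    unfolding cinner_self[symmetric] by (rule cinner_sum_self[OF assms])
  also have "\<dots> = complex_of_real (\<Sum>i\<in>F. (cmod (c i))\<^sup>2)"
    by (simp add: complex_norm_square[symmetric] del: of_real_power)
  finally show ?thesis
    using of_real_eq_iff by blast
qed

lemma bessel_inequality:
  assumes "finite F"
    and "\<And>i j. i \<in> F \<Longrightarrow> j \<in> F \<Longrightarrow> cinner (b i) (b j) = (if i = j then 1 else 0)"
  shows "(\<Sum>i\<in>F. (cmod (cinner k (b i)))\<^sup>2) \<le> (norm k)\<^sup>2"
proof -
  define c where "c i = cinner k (b i)" for i
  define p where "p = (\<Sum>i\<in>F. c i *\<^sub>C b i)"
  have "cinner k p = (\<Sum>i\<in>F. c i * cnj (c i))"
    by (simp add: p_def cinner.sum_right cinner_scaleC_right c_def mult.commute)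
  also have "\<dots> = complex_of_real (\<Sum>i\<in>F. (cmod (c i))\<^sup>2)"
    by (simp add: complex_norm_square[symmetric] del: of_real_power)
  finally have "inner k p = (\<Sum>i\<in>F. (cmod (c i))\<^sup>2)"
    by (metis Re_cinner Re_complex_of_real)
  moreover have "(norm p)\<^sup>2 = (\<Sum>i\<in>F. (cmod (c i))\<^sup>2)"
    unfolding p_def by (rule norm_orthonormal_sum[OF assms])
  moreover have "(norm (k - p))\<^sup>2 = (norm k)\<^sup>2 - 2 * inner k p + (norm p)\<^sup>2"
    by (simp add: power2_norm_eq_inner inner_diff_left inner_diff_right inner_commute)
  ultimately show ?thesis
    unfolding c_def by (smt (verit) zero_le_power2)
qed

text \<open>
  The Cauchy criterion for unordered sums. Sums over an orthonormal family need it: they may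
  converge without converging absolutely.
\<close>

lemma summable_on_CauchyI:
  fixes f :: "'i \<Rightarrow> 'a::banach"
  assumes "\<And>e. e > 0 \<Longrightarrow> \<exists>F0. finite F0 \<and> F0 \<subseteq> I \<and>
    (\<forall>F. finite F \<longrightarrow> F \<subseteq> I \<longrightarrow> F \<inter> F0 = {} \<longrightarrow> norm (sum f F) < e)"
  shows "f summable_on I"
proof -
  have "\<exists>P. eventually P (finite_subsets_at_top I) \<and>
      (\<forall>F F'. P F \<and> P F' \<longrightarrow> dist (sum f F) (sum f F') < e)" if "e > 0" for e
  proof -
    obtain F0 where F0: "finite F0" "F0 \<subseteq> I"
      and small: "\<And>F. finite F \<Longrightarrow> F \<subseteq> I \<Longrightarrow> F \<inter> F0 = {} \<Longrightarrow> norm (sum f F) < e / 2"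
      using assms[of "e/2"] \<open>e > 0\<close> by auto
    define P where "P F \<longleftrightarrow> finite F \<and> F0 \<subseteq> F \<and> F \<subseteq> I" for F
    have near: "dist (sum f F) (sum f F0) < e / 2" if "P F" for F
      using small[of "F - F0"] that
      by (auto simp: P_def dist_norm sum_diff F0(1) norm_minus_commute)
    have "dist (sum f F) (sum f F') < e" if "P F" "P F'" for F F'
      using near[OF that(1)] near[OF that(2)] dist_triangle2[of "sum f F" "sum f F'" "sum f F0"]
      by linarith
    moreover have "eventually P (finite_subsets_at_top I)"
      unfolding eventually_finite_subsets_at_top P_def using F0 by blast
    ultimately show ?thesis by blast
  qed
  then have "cauchy_filter (filtermap (sum f) (finite_subsets_at_top I))"
    by (simp add: cauchy_filter_metric_filtermap)
  moreover have "complete (UNIV :: 'a set)"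
    by (meson Cauchy_convergent UNIV_I complete_def convergent_def)
  ultimately obtain L where "(sum f \<longlongrightarrow> L) (finite_subsets_at_top I)"
    using complete_uniform[where S = UNIV] by (force simp add: filterlim_def)
  then show ?thesis
    using summable_on_def has_sum_def by blast
qed

text \<open>
  The bound says that \<open>c \<mapsto> (\<Sum>i. c i *\<^sub>C v i)\<close> is bounded on finitely supported sequences for the
  \<open>\<ell>\<^sup>2\<close> norm. The coefficients \<open>cinner k (b i)\<close> are square summable by Bessel's inequality, so the
  tails of the sum defining \<open>V k\<close> are small.
\<close>

lemma orthonormal_extension:
  fixes b :: "'i \<Rightarrow> 'a::chilbert_space"
    and v :: "'i \<Rightarrow> 'b::{complex_normed_vector, banach}"
  assumes on: "\<And>i j. i \<in> I \<Longrightarrow> j \<in> I \<Longrightarrow> cinner (b i) (b j) = (if i = j then 1 else 0)"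
    and C: "C \<ge> 0"
    and bound: "\<And>F c. finite F \<Longrightarrow> F \<subseteq> I \<Longrightarrow>
      norm (\<Sum>i\<in>F. c i *\<^sub>C v i) \<le> C * sqrt (\<Sum>i\<in>F. (cmod (c i))\<^sup>2)"
  obtains V :: "'a \<Rightarrow>\<^sub>L 'b" where "V \<in> cbounded"
    and "\<And>k. ((\<lambda>i. cinner k (b i) *\<^sub>C v i) has_sum V k) I"
    and "\<And>i. i \<in> I \<Longrightarrow> V (b i) = v i"
proof -
  have bessel: "(\<Sum>i\<in>F. (cmod (cinner k (b i)))\<^sup>2) \<le> (norm k)\<^sup>2" if "finite F" "F \<subseteq> I" for F k
    using that by (intro bessel_inequality on) auto
  have "(\<lambda>i. cinner k (b i) *\<^sub>C v i) summable_on I" for k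
  proof (rule summable_on_CauchyI)
    fix e :: real assume "e > 0"
    define g where "g i = (cmod (cinner k (b i)))\<^sup>2" for i
    have "g summable_on I"
    proof (rule nonneg_bdd_above_summable_on)
      show "bdd_above (sum g ` {F. F \<subseteq> I \<and> finite F})"
        unfolding g_def using bessel[of _ k] by (auto intro!: bdd_aboveI)
    qed (simp add: g_def)
    then obtain s where s: "(g has_sum s) I" by (auto simp: summable_on_def)
    \<comment> \<open>\<open>C + 1\<close> in place of \<open>C\<close> covers \<open>C = 0\<close>.\<close>
    define d where "d = (e / (C + 1))\<^sup>2"
    have "d > 0" using \<open>e > 0\<close> C by (simp add: d_def)
    then obtain F0 where F0: "finite F0" "F0 \<subseteq> I" "dist (sum g F0) s \<le> d / 2"
      using has_sum_finite_approximation[OF s, of "d/2"] by auto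
    have "norm (\<Sum>i\<in>F. cinner k (b i) *\<^sub>C v i) < e"
      if F: "finite F" "F \<subseteq> I" "F \<inter> F0 = {}" for F
    proof -
      have "sum g F + sum g F0 = sum g (F \<union> F0)"
        using F F0 by (simp add: sum.union_disjoint)
      also have "\<dots> \<le> s"
        by (rule finite_sum_le_has_sum[OF s]) (use F F0 in \<open>auto simp: g_def\<close>)
      finally have "sum g F < d"
        using F0(3) \<open>d > 0\<close> by (simp add: dist_real_def abs_if split: if_splits)
      then have "sqrt (sum g F) < e / (C + 1)"
        using \<open>e > 0\<close> C by (simp add: d_def real_less_lsqrt sum_nonneg g_def)
      then have "C * sqrt (sum g F) \<le> C * (e / (C + 1))"
        using C by (intro mult_left_mono) auto
      also have "\<dots> < e" using C \<open>e > 0\<close> by (simp add: field_simps)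
      finally show ?thesis
        using bound[OF F(1,2), of "\<lambda>i. cinner k (b i)"] by (simp add: g_def)
    qed
    with F0 show "\<exists>F0. finite F0 \<and> F0 \<subseteq> I \<and> (\<forall>F. finite F \<longrightarrow> F \<subseteq> I \<longrightarrow> F \<inter> F0 = {} \<longrightarrow>
        norm (\<Sum>i\<in>F. cinner k (b i) *\<^sub>C v i) < e)" by blast
  qed
  then obtain V where V: "\<And>k. ((\<lambda>i. cinner k (b i) *\<^sub>C v i) has_sum V k) I"
    unfolding summable_on_def by metis
  have Vc: "V (c *\<^sub>C x) = c *\<^sub>C V x" for c x
    using has_sum_bounded_linear[OF bounded_linear_scaleC V[of x], of c] V[of "c *\<^sub>C x"]
    by (simp add: cinner_scaleC_left scaleC_scaleC has_sum_unique)
  have "bounded_linear V"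
  proof (rule bounded_linear_intro[of _ C])
    show "V (x + y) = V x + V y" for x y
      using has_sum_add[OF V[of x] V[of y]] V[of "x + y"]
      by (simp add: cinner_add_left scaleC_add_left has_sum_unique)
    show "V (r *\<^sub>R x) = r *\<^sub>R V x" for r x
      unfolding scaleR_scaleC by (rule Vc)
    show "norm (V k) \<le> norm k * C" for k
    proof -
      have "eventually (\<lambda>F. norm (\<Sum>i\<in>F. cinner k (b i) *\<^sub>C v i) \<le> norm k * C)
          (finite_subsets_at_top I)"
      proof (rule eventually_finite_subsets_at_top_weakI)
        fix F assume F: "finite F" "F \<subseteq> I"
        have "norm (\<Sum>i\<in>F. cinner k (b i) *\<^sub>C v i) \<le> C * sqrt (\<Sum>i\<in>F. (cmod (cinner k (b i)))\<^sup>2)"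
          by (rule bound[OF F])
        also have "\<dots> \<le> C * norm k"
          using bessel[OF F, of k] C by (intro mult_left_mono real_le_lsqrt) (auto intro: sum_nonneg)
        finally show "norm (\<Sum>i\<in>F. cinner k (b i) *\<^sub>C v i) \<le> norm k * C"
          by (simp add: mult.commute)
      qed
      moreover have "((\<lambda>F. norm (\<Sum>i\<in>F. cinner k (b i) *\<^sub>C v i)) \<longlongrightarrow> norm (V k))
          (finite_subsets_at_top I)"
        using V[of k] unfolding has_sum_def by (rule tendsto_norm)
      ultimately show ?thesis
        by (intro tendsto_upperbound) auto
    qed
  qed
  then have app: "blinfun_apply (Blinfun V) = V"
    by (simp add: bounded_linear_Blinfun_apply)
  have "V (b i) = v i" if "i \<in> I" for i
  proof -
    have "((\<lambda>j. cinner (b i) (b j) *\<^sub>C v j) has_sum v i) I"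
      by (rule has_sum_finite_neutralI[of "{i}"]) (use that on in \<open>auto simp: scaleC_one\<close>)
    then show ?thesis using V has_sum_unique by blast
  qed
  then show thesis
    using that[of "Blinfun V"] V by (simp add: app cbounded_def Vc)
qed

lemma bounded_linear_zero_closure:
  fixes f :: "'a::chilbert_space \<Rightarrow> 'b::complex_normed_vector"
  assumes "bounded_linear f" "\<And>c x. f (c *\<^sub>C x) = c *\<^sub>C f x" "\<And>x. x \<in> B \<Longrightarrow> f x = 0"
    and "x \<in> closure (cspan B)"
  shows "f x = 0"
proof -
  interpret f: bounded_linear f by fact
  have "f x = 0" if "x \<in> cspan B" for x
    using that
    by (induction rule: complex_vector.span_induct_alt) (simp_all add: assms f.zero f.add)
  then have "cspan B \<subseteq> {x. f x = 0}" by blast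
  moreover have "closed {x. f x = 0}"
    by (intro closed_Collect_eq f.continuous_on continuous_intros)
  ultimately show ?thesis
    using assms(4) closure_minimal by blast
qed

lemma orthonormal_basis_orthonormal:
  "orthonormal_basis I b \<Longrightarrow> i \<in> I \<Longrightarrow> j \<in> I \<Longrightarrow> cinner (b i) (b j) = (if i = j then 1 else 0)"
  by (simp add: orthonormal_basis_def)

lemma orthonormal_basis_eqI:
  fixes A B :: "'a::chilbert_space \<Rightarrow>\<^sub>L 'b::complex_normed_vector"
  assumes "orthonormal_basis I b" "A \<in> cbounded" "B \<in> cbounded" "\<And>i. i \<in> I \<Longrightarrow> A (b i) = B (b i)"
  shows "A = B"
proof -
  have "(A - B) x = 0" for x
    by (rule bounded_linear_zero_closure[OF blinfun.bounded_linear_right, of _ "b ` I"])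
      (use assms in \<open>auto simp: cbounded_apply cbounded_diff orthonormal_basis_def blinfun.diff_left
        complex_vector.scale_right_diff_distrib\<close>)
  then show ?thesis
    by (intro blinfun_eqI) (simp add: blinfun.diff_left)
qed

text \<open>
  Moving some basis vectors injectively to basis vectors and killing the others does not increase
  the norm of any finite combination; creation operators and vertex projections are both of this kind.
\<close>

lemma partial_shift_exists:
  fixes b :: "'i \<Rightarrow> 'a::chilbert_space"
  assumes "orthonormal_basis I b" and J: "J \<subseteq> I" and s: "s ` J \<subseteq> I" "inj_on s J"
  obtains V :: "'a \<Rightarrow>\<^sub>L 'a" where "V \<in> cbounded"
    and "\<And>i. i \<in> I \<Longrightarrow> V (b i) = (if i \<in> J then b (s i) else 0)"
proof (rule orthonormal_extension[where b = b and I = I and C = 1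
      and v = "\<lambda>i. if i \<in> J then b (s i) else 0"])
  show "cinner (b i) (b j) = (if i = j then 1 else 0)" if "i \<in> I" "j \<in> I" for i j
    using assms(1) that by (rule orthonormal_basis_orthonormal)
  fix F and c :: "'i \<Rightarrow> complex" assume F: "finite F" "F \<subseteq> I"
  have "(\<Sum>i\<in>F. c i *\<^sub>C (if i \<in> J then b (s i) else 0)) = (\<Sum>i\<in>F \<inter> J. c i *\<^sub>C b (s i))"
    by (simp add: sum.inter_restrict F if_distrib[of "\<lambda>x. _ *\<^sub>C x"] cong: if_cong)
  moreover have "(norm (\<Sum>i\<in>F \<inter> J. c i *\<^sub>C b (s i)))\<^sup>2 = (\<Sum>i\<in>F \<inter> J. (cmod (c i))\<^sup>2)"
    by (rule norm_orthonormal_sum)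
      (use F s in \<open>auto simp: orthonormal_basis_orthonormal[OF assms(1)] image_subset_iff
        inj_on_def\<close>)
  moreover have "\<dots> \<le> (\<Sum>i\<in>F. (cmod (c i))\<^sup>2)"
    using F by (intro sum_mono2) auto
  ultimately show "norm (\<Sum>i\<in>F. c i *\<^sub>C (if i \<in> J then b (s i) else 0))
      \<le> 1 * sqrt (\<Sum>i\<in>F. (cmod (c i))\<^sup>2)"
    by (simp add: real_le_rsqrt)
qed (use that in auto)

section \<open>Positive semidefinite matrices\<close>

definition quad_form :: "'i set \<Rightarrow> ('i \<Rightarrow> 'i \<Rightarrow> complex) \<Rightarrow> ('i \<Rightarrow> complex) \<Rightarrow> complex" where
  "quad_form F M c = (\<Sum>i\<in>F. \<Sum>j\<in>F. c i * cnj (c j) * M i j)"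

definition pos_semidef :: "'i set \<Rightarrow> ('i \<Rightarrow> 'i \<Rightarrow> complex) \<Rightarrow> bool" where
  "pos_semidef F M \<longleftrightarrow> (\<forall>i\<in>F. \<forall>j\<in>F. M j i = cnj (M i j)) \<and> (\<forall>c. 0 \<le> Re (quad_form F M c))"

lemma pos_semidef_herm: "pos_semidef F M \<Longrightarrow> i \<in> F \<Longrightarrow> j \<in> F \<Longrightarrow> M j i = cnj (M i j)"
  unfolding pos_semidef_def by blast

lemma pos_semidef_nonneg: "pos_semidef F M \<Longrightarrow> 0 \<le> Re (quad_form F M c)"
  unfolding pos_semidef_def by blast

lemma quad_form_insert:
  assumes "finite F" "a \<notin> F"
  shows "quad_form (insert a F) M c = c a * cnj (c a) * M a a + c a * (\<Sum>j\<in>F. cnj (c j) * M a j)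
    + cnj (c a) * (\<Sum>i\<in>F. c i * M i a) + quad_form F M c"
  using assms by (simp add: quad_form_def sum.distrib sum_distrib_left algebra_simps)

lemma pos_semidef_insertD:
  assumes "finite F" "a \<notin> F" "pos_semidef (insert a F) M"
  shows "pos_semidef F M"
proof -
  have "0 \<le> Re (quad_form F M c)" for c
  proof -
    define d where "d = c(a := 0)"
    have "quad_form F M d = quad_form F M c"
      unfolding quad_form_def d_def using assms(2) by (intro sum.cong refl) auto
    moreover have "0 \<le> Re (quad_form (insert a F) M d)"
      by (rule pos_semidef_nonneg[OF assms(3)])
    ultimately show ?thesis
      by (simp add: quad_form_insert[OF assms(1,2)] d_def)
  qed
  with assms(3) show ?thesis unfolding pos_semidef_def by blast
qed

lemma pos_semidef_diag:
  assumes "finite F" "a \<notin> F" "pos_semidef (insert a F) M"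
  shows "0 \<le> Re (M a a)" "M a a = complex_of_real (Re (M a a))"
proof -
  define c where "c = (\<lambda>i. if i = a then 1 else 0 :: complex)"
  have c: "c i = 0" if "i \<in> F" for i
    using assms(2) that by (auto simp: c_def)
  have "quad_form (insert a F) M c = M a a"
    unfolding quad_form_insert[OF assms(1,2)] by (simp add: quad_form_def c) (simp add: c_def)
  then show "0 \<le> Re (M a a)"
    using pos_semidef_nonneg[OF assms(3), of c] by simp
  have "M a a = cnj (M a a)"
    by (rule pos_semidef_herm[OF assms(3)]) simp_all
  from arg_cong[OF this, of Im] show "M a a = complex_of_real (Re (M a a))"
    by (intro complex_eqI) simp_all
qed

lemma pos_semidef_zero_diag:
  assumes F: "finite F" "a \<notin> F" and psd: "pos_semidef (insert a F) M" and "M a a = 0" "j \<in> F"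
  shows "M j a = 0" "M a j = 0"
proof -
  define z where "z = M j a"
  have aj: "M a j = cnj z"
    unfolding z_def by (rule pos_semidef_herm[OF psd]) (use \<open>j \<in> F\<close> in auto)
  have le: "2 * t * (cmod z)\<^sup>2 \<le> Re (M j j)" for t :: real
  proof -
    define c where "c i = (if i = a then - complex_of_real t * z else if i = j then 1 else 0)" for i
    have cF: "c i = (if i = j then 1 else 0)" if "i \<in> F" for i
      using that F(2) by (auto simp: c_def)
    have s1: "(\<Sum>i\<in>F. c i * M i a) = z"
    proof -
      have "(\<Sum>i\<in>F. c i * M i a) = (\<Sum>i\<in>F. if i = j then M i a else 0)"
        by (rule sum.cong) (simp_all add: cF)
      then show ?thesis using F(1) \<open>j \<in> F\<close> by (simp add: z_def)
    qed
    have s2: "(\<Sum>i\<in>F. cnj (c i) * M a i) = cnj z"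
    proof -
      have "(\<Sum>i\<in>F. cnj (c i) * M a i) = (\<Sum>i\<in>F. if i = j then M a i else 0)"
        by (rule sum.cong) (simp_all add: cF)
      then show ?thesis using F(1) \<open>j \<in> F\<close> by (simp add: aj)
    qed
    have s3: "quad_form F M c = M j j"
    proof -
      have "quad_form F M c = (\<Sum>i\<in>F. if i = j then (\<Sum>k\<in>F. if k = j then M i k else 0) else 0)"
        unfolding quad_form_def by (intro sum.cong refl) (auto simp: cF intro!: sum.cong)
      then show ?thesis using F(1) \<open>j \<in> F\<close> by simp
    qed
    have ca: "c a = - complex_of_real t * z" by (simp add: c_def)
    have "quad_form (insert a F) M c = M j j - complex_of_real (2 * t) * (z * cnj z)"
      unfolding quad_form_insert[OF F] s1 s2 s3 ca by (simp add: \<open>M a a = 0\<close> algebra_simps)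
    also have "z * cnj z = complex_of_real ((cmod z)\<^sup>2)"
      by (rule complex_norm_square[symmetric])
    finally have "Re (quad_form (insert a F) M c) = Re (M j j) - 2 * t * (cmod z)\<^sup>2"
      by (simp del: of_real_power)
    then show ?thesis
      using pos_semidef_nonneg[OF psd, of c] by simp
  qed
  have "z = 0"
  proof (rule ccontr)
    assume "z \<noteq> 0"
    then have "2 * ((Re (M j j) + 1) / (2 * (cmod z)\<^sup>2)) * (cmod z)\<^sup>2 = Re (M j j) + 1"
      by (simp add: field_simps)
    with le[of "(Re (M j j) + 1) / (2 * (cmod z)\<^sup>2)"] show False by simp
  qed
  then show "M j a = 0" "M a j = 0"
    by (simp_all add: z_def aj)
qed

text \<open>
  Schur's product theorem, evaluated at the all-ones vector. Each step of the induction splits off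
  a rank-one summand of \<open>M\<close> (one step of a Cholesky decomposition), on which the sum is a value of
  the form \<open>N\<close>; the remaining Schur complement lives on a smaller index set.
\<close>

lemma schur_product_nonneg:
  assumes "finite F" "pos_semidef F M" "pos_semidef F N"
  shows "0 \<le> Re (\<Sum>i\<in>F. \<Sum>j\<in>F. M i j * N i j)"
  using assms
proof (induction F arbitrary: M rule: finite_induct)
  case (insert a F)
  note F = insert.hyps and M = \<open>pos_semidef (insert a F) M\<close> and N = \<open>pos_semidef (insert a F) N\<close>
  have split: "(\<Sum>i\<in>insert a F. \<Sum>j\<in>insert a F. K i j * N i j) = (\<Sum>i\<in>F. \<Sum>j\<in>F. K i j * N i j)"
    if "\<And>j. j \<in> insert a F \<Longrightarrow> K a j = 0" "\<And>j. j \<in> insert a F \<Longrightarrow> K j a = 0" for K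
    using F that by simp
  show ?case
  proof (cases "M a a = 0")
    case True
    show ?thesis
      by (subst split)
        (use True pos_semidef_zero_diag[OF F M True] pos_semidef_insertD[OF F M]
          pos_semidef_insertD[OF F N] insert.IH in auto)
  next
    case False
    define m where "m = Re (M a a)"
    have Maa: "M a a = complex_of_real m"
      unfolding m_def by (rule pos_semidef_diag(2)[OF F M])
    have m: "m > 0"
    proof -
      have "m \<ge> 0" unfolding m_def by (rule pos_semidef_diag(1)[OF F M])
      moreover have "m \<noteq> 0" using False unfolding Maa by auto
      ultimately show ?thesis by simp
    qed
    have herm: "M j i = cnj (M i j)" if "i \<in> insert a F" "j \<in> insert a F" for i j
      by (rule pos_semidef_herm[OF M that])
    define M' where "M' i j = M i j - M i a * M a j / complex_of_real m" for i j
    have "pos_semidef F M'"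
      unfolding pos_semidef_def
    proof (intro conjI ballI allI)
      fix i j assume i: "i \<in> F" and j: "j \<in> F"
      have "cnj (M i j) = M j i" "cnj (M i a) = M a i" "cnj (M a j) = M j a"
        using i j by (auto intro!: herm[symmetric])
      then show "M' j i = cnj (M' i j)"
        by (simp add: M'_def mult.commute)
    next
      fix c
      define s where "s = (\<Sum>i\<in>F. c i * M i a)"
      define d where "d = c(a := - s / complex_of_real m)"
      have dF: "d i = c i" if "i \<in> F" for i
        using that F(2) by (auto simp: d_def)
      have s1: "(\<Sum>i\<in>F. d i * M i a) = s"
        by (simp add: s_def dF)
      have s2': "(\<Sum>j\<in>F. cnj (c j) * M a j) = cnj s"
        unfolding s_def cnj_sum complex_cnj_mult
        by (intro sum.cong refl arg_cong2[where f = "(*)"] herm) auto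
      then have s2: "(\<Sum>j\<in>F. cnj (d j) * M a j) = cnj s"
        by (simp add: dF)
      have s3: "quad_form F M d = quad_form F M c"
        by (simp add: quad_form_def dF)
      have da: "d a = - s / complex_of_real m" by (simp add: d_def)
      have "quad_form (insert a F) M d = quad_form F M c - s * cnj s / complex_of_real m"
        unfolding quad_form_insert[OF F] s1 s2 s3 da Maa using m by (simp add: field_simps)
      also have "s * cnj s = (\<Sum>i\<in>F. \<Sum>j\<in>F. c i * M i a * (cnj (c j) * M a j))"
        unfolding s2'[symmetric] unfolding s_def by (rule sum_product)
      finally have "quad_form (insert a F) M d = quad_form F M' c"
        by (simp add: quad_form_def M'_def sum_subtractf sum_divide_distrib algebra_simps)
      then show "0 \<le> Re (quad_form F M' c)"
        using pos_semidef_nonneg[OF M, of d] by simp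
    qed
    with insert.IH N have IH: "0 \<le> Re (\<Sum>i\<in>F. \<Sum>j\<in>F. M' i j * N i j)"
      using pos_semidef_insertD[OF F N] by blast
    have "(\<Sum>i\<in>insert a F. \<Sum>j\<in>insert a F. M i a * M a j * N i j) = quad_form (insert a F) N (\<lambda>i. M i a)"
      unfolding quad_form_def
      by (intro sum.cong refl) (metis herm insertI1)
    then have rank1: "0 \<le> Re (\<Sum>i\<in>insert a F. \<Sum>j\<in>insert a F. M i a * M a j * N i j)"
      using pos_semidef_nonneg[OF N] by simp
    have "(\<Sum>i\<in>insert a F. \<Sum>j\<in>insert a F. M i j * N i j)
        = (\<Sum>i\<in>insert a F. \<Sum>j\<in>insert a F. M' i j * N i j + (M i a * M a j * N i j) / complex_of_real m)"
      by (intro sum.cong refl) (simp add: M'_def algebra_simps)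
    also have "\<dots> = (\<Sum>i\<in>insert a F. \<Sum>j\<in>insert a F. M' i j * N i j)
        + (\<Sum>i\<in>insert a F. \<Sum>j\<in>insert a F. M i a * M a j * N i j) / complex_of_real m"
      by (simp only: sum.distrib sum_divide_distrib)
    also have "(\<Sum>i\<in>insert a F. \<Sum>j\<in>insert a F. M' i j * N i j) = (\<Sum>i\<in>F. \<Sum>j\<in>F. M' i j * N i j)"
      by (rule split) (use m in \<open>simp_all add: M'_def Maa\<close>)
    finally show ?thesis
      using IH rank1 m by (simp only: plus_complex.sel Re_divide_of_real) simp
  qed
qed simp

text \<open>
  If the matrix \<open>a\<close> has norm at most \<open>C\<close>, then so has its amplification to the semi-inner product
  space with form \<open>(x, y) \<mapsto> cinner (D x) y\<close>. The difference of the two sides pairs the Gram matrix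
  of the vectors \<open>x v\<close> entrywise with the positive semidefinite matrix \<open>C\<^sup>2 - a a\<^sup>*\<close>.
\<close>

lemma amplification_bound:
  fixes D :: "'h::chilbert_space \<Rightarrow>\<^sub>L 'h" and x :: "'v \<Rightarrow> 'h" and a :: "'v \<Rightarrow> 'w \<Rightarrow> complex"
  assumes "finite E" and D: "D \<in> cbounded"
    and herm: "\<And>x y. cinner (D x) y = cinner x (D y)" and pos: "\<And>x. 0 \<le> Re (cinner (D x) x)"
    and bound: "\<And>y. (\<Sum>w\<in>F. (cmod (\<Sum>v\<in>E. y v * a v w))\<^sup>2) \<le> C\<^sup>2 * (\<Sum>v\<in>E. (cmod (y v))\<^sup>2)"
  shows "(\<Sum>w\<in>F. Re (cinner (D (\<Sum>v\<in>E. cnj (a v w) *\<^sub>C x v)) (\<Sum>v\<in>E. cnj (a v w) *\<^sub>C x v)))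
    \<le> C\<^sup>2 * (\<Sum>v\<in>E. Re (cinner (D (x v)) (x v)))"
proof -
  define N where "N v v' = cinner (D (x v')) (x v)" for v v'
  define M where "M v v' = (if v = v' then complex_of_real (C\<^sup>2) else 0) - (\<Sum>w\<in>F. a v w * cnj (a v' w))"
    for v v'
  have Dsum: "D (\<Sum>v\<in>E. f v) = (\<Sum>v\<in>E. D (f v))" for f
    by (rule blinfun.sum_right)
  have quadN: "quad_form E N c = cinner (D (\<Sum>v\<in>E. cnj (c v) *\<^sub>C x v)) (\<Sum>v\<in>E. cnj (c v) *\<^sub>C x v)" for c
    unfolding quad_form_def N_def
    by (simp add: Dsum cbounded_apply[OF D] cinner.sum_left cinner.sum_right cinner_scaleC_left
        cinner_scaleC_right sum_distrib_left mult_ac)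
  have "N j i = cnj (N i j)" for i j
    unfolding N_def by (metis herm cinner_commute)
  moreover have "0 \<le> Re (quad_form E N c)" for c
    unfolding quadN by (rule pos)
  ultimately have "pos_semidef E N"
    unfolding pos_semidef_def by blast
  moreover have "pos_semidef E M"
    unfolding pos_semidef_def
  proof (intro conjI ballI allI)
    show "M v' v = cnj (M v v')" for v v'
      by (simp add: M_def mult.commute)
    fix c
    have "quad_form E M c = (\<Sum>v\<in>E. \<Sum>v'\<in>E. if v = v' then C\<^sup>2 * (c v * cnj (c v')) else 0)
        - (\<Sum>v\<in>E. \<Sum>v'\<in>E. \<Sum>w\<in>F. c v * a v w * cnj (c v' * a v' w))"
      unfolding quad_form_def M_def sum_subtractf[symmetric]
      by (intro sum.cong refl) (simp add: sum_distrib_left algebra_simps)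
    also have "(\<Sum>v\<in>E. \<Sum>v'\<in>E. if v = v' then C\<^sup>2 * (c v * cnj (c v')) else 0)
        = complex_of_real (C\<^sup>2 * (\<Sum>v\<in>E. (cmod (c v))\<^sup>2))"
      using \<open>finite E\<close> by (simp add: sum_distrib_left complex_norm_square[symmetric] del: of_real_power)
    also have "(\<Sum>v\<in>E. \<Sum>v'\<in>E. \<Sum>w\<in>F. c v * a v w * cnj (c v' * a v' w))
        = (\<Sum>w\<in>F. (\<Sum>v\<in>E. c v * a v w) * cnj (\<Sum>v\<in>E. c v * a v w))"
      unfolding cnj_sum sum_product by (subst sum.swap[of _ F], intro sum.cong refl sum.swap)
    also have "\<dots> = complex_of_real (\<Sum>w\<in>F. (cmod (\<Sum>v\<in>E. c v * a v w))\<^sup>2)"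
      by (simp only: of_real_sum complex_norm_square)
    finally show "0 \<le> Re (quad_form E M c)"
      using bound[of c] by (simp del: of_real_power)
  qed
  ultimately have "0 \<le> Re (\<Sum>v\<in>E. \<Sum>v'\<in>E. M v v' * N v v')"
    using schur_product_nonneg[OF \<open>finite E\<close>] by blast
  also have "(\<Sum>v\<in>E. \<Sum>v'\<in>E. M v v' * N v v')
      = (\<Sum>v\<in>E. \<Sum>v'\<in>E. if v = v' then C\<^sup>2 * N v v' else 0)
      - (\<Sum>v\<in>E. \<Sum>v'\<in>E. \<Sum>w\<in>F. a v w * cnj (a v' w) * N v v')"
    unfolding sum_subtractf[symmetric] M_def
    by (intro sum.cong refl) (simp add: sum_distrib_right left_diff_distrib)
  also have "(\<Sum>v\<in>E. \<Sum>v'\<in>E. \<Sum>w\<in>F. a v w * cnj (a v' w) * N v v') = (\<Sum>w\<in>F. quad_form E N (\<lambda>v. a v w))"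
    unfolding quad_form_def by (subst sum.swap[of _ F], intro sum.cong refl sum.swap)
  also have "(\<Sum>v\<in>E. \<Sum>v'\<in>E. if v = v' then C\<^sup>2 * N v v' else 0) = C\<^sup>2 * (\<Sum>v\<in>E. N v v)"
    using \<open>finite E\<close> by (simp add: sum_distrib_left)
  finally show ?thesis
    unfolding quadN by (simp add: N_def del: of_real_power)
qed

section \<open>The Poisson identity\<close>

lemma has_sum_cinner_left:
  "(f has_sum S) I \<Longrightarrow> ((\<lambda>i. cinner (f i) y) has_sum cinner S y) I"
  by (rule has_sum_bounded_linear[OF cinner.bounded_linear_left])

definition path_op :: "('e \<Rightarrow> 'h::real_normed_vector \<Rightarrow>\<^sub>L 'h) \<Rightarrow> 'e list \<Rightarrow> 'h \<Rightarrow>\<^sub>L 'h" where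
  "path_op S es = foldr (\<lambda>e B. S e o\<^sub>L B) es id_blinfun"

lemma path_op_simps [simp]:
  "path_op S [] = id_blinfun" "path_op S (e # es) = S e o\<^sub>L path_op S es"
  by (simp_all add: path_op_def)

locale strict_row_contraction =
  fixes E :: "'e set" and S :: "'e \<Rightarrow> 'h::chilbert_space \<Rightarrow>\<^sub>L 'h" and R :: "'h \<Rightarrow>\<^sub>L 'h" and q :: real
  assumes S_cbounded: "e \<in> E \<Longrightarrow> S e \<in> cbounded"
    and R_sum: "has_strong_sum (\<lambda>e. S e o\<^sub>L adj (S e)) R E"
    and R_le: "Re (cinner (R x) x) \<le> q * (norm x)\<^sup>2"
    and q: "0 \<le> q" "q < 1"
begin

lemma cinner_R_sum:
  "((\<lambda>e. cinner (adj (S e) x) (adj (S e) y)) has_sum cinner (R x) y) E"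
proof -
  have "((\<lambda>e. cinner ((S e o\<^sub>L adj (S e)) x) y) has_sum cinner (R x) y) E"
    using R_sum by (intro has_sum_cinner_left) (simp add: has_strong_sum_def)
  then show ?thesis
    by (subst has_sum_cong) (auto simp: cinner_adj_right S_cbounded)
qed

lemma R_sum_norm: "((\<lambda>e. (norm (adj (S e) x))\<^sup>2) has_sum Re (cinner (R x) x)) E"
  using has_sum_Re[OF cinner_R_sum[of x x]] by (simp add: cinner_self del: of_real_power)

lemma R_hermitian: "cinner (R x) y = cinner x (R y)"
proof -
  have "((\<lambda>e. cnj (cinner (adj (S e) y) (adj (S e) x))) has_sum cnj (cinner (R y) x)) E"
    unfolding has_sum_cnj_iff by (rule cinner_R_sum)
  then have "((\<lambda>e. cinner (adj (S e) x) (adj (S e) y)) has_sum cinner x (R y)) E"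
    by (simp flip: cinner_commute)
  then show ?thesis
    using cinner_R_sum has_sum_unique by blast
qed

lemma R_cbounded: "R \<in> cbounded"
  unfolding cbounded_def
proof (intro CollectI allI)
  fix c x
  have "cinner (R (c *\<^sub>C x)) y = cinner (c *\<^sub>C R x) y" for y
    by (simp add: R_hermitian cinner_scaleC_left)
  then have "cinner (R (c *\<^sub>C x) - c *\<^sub>C R x) (R (c *\<^sub>C x) - c *\<^sub>C R x) = 0"
    by (simp add: cinner.diff_left)
  then show "R (c *\<^sub>C x) = c *\<^sub>C R x"
    by (simp add: cinner_self)
qed

text \<open>
  The squared norm of \<open>D\<^sup>1\<^sup>/\<^sup>2 x\<close> for the defect operator \<open>D = id - R\<close>; only the quadratic form of \<open>D\<close>
  is needed, so no square root has to be taken.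
\<close>

definition defect :: "'h \<Rightarrow> real" where
  "defect x = (norm x)\<^sup>2 - Re (cinner (R x) x)"

lemma defect_ge: "(1 - q) * (norm x)\<^sup>2 \<le> defect x"
  using R_le[of x] by (simp add: defect_def algebra_simps)

lemma defect_nonneg: "0 \<le> defect x"
  by (rule order_trans[OF _ defect_ge]) (use q in simp)

lemma cbounded_id_blinfun: "id_blinfun \<in> cbounded"
  by (simp add: cbounded_def)

lemma path_op_cbounded: "set es \<subseteq> E \<Longrightarrow> path_op S es \<in> cbounded"
  by (induction es) (simp_all add: cbounded_id_blinfun cbounded_compose S_cbounded)

lemma adj_id_blinfun: "adj id_blinfun = id_blinfun"
  by (rule adj_eqI) simp

text \<open>
  Peeling off the first letter \<open>e\<close> turns a sum at \<open>g\<close> into sums at \<open>adj (S e) g\<close>, and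
  \<open>\<parallel>g\<parallel>\<^sup>2 = defect g + (\<Sum>e. \<parallel>adj (S e) g\<parallel>\<^sup>2)\<close>; so the partial sums over words of length at most
  \<open>n\<close> miss \<open>\<parallel>g\<parallel>\<^sup>2\<close> only by the norms over words of length \<open>n + 1\<close>.
\<close>

lemma poisson_partial:
  "\<exists>s. ((\<lambda>es. defect (adj (path_op S es) g)) has_sum s) {es \<in> lists E. length es \<le> n} \<and>
    (1 - q ^ Suc n) * (norm g)\<^sup>2 \<le> s \<and> s \<le> (norm g)\<^sup>2"
proof (induction n arbitrary: g)
  case 0
  have "{es \<in> lists E. length es \<le> 0} = {[]}" by auto
  moreover have "((\<lambda>es. defect (adj (path_op S es) g)) has_sum defect g) {[]}"
    by (rule has_sum_finiteI) (simp_all add: adj_id_blinfun)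
  moreover have "0 \<le> Re (cinner (R g) g)"
    by (rule has_sum_nonneg[OF R_sum_norm]) simp
  ultimately show ?case
    using defect_ge[of g] by (intro exI[of _ "defect g"]) (simp add: defect_def)
next
  case (Suc n)
  let ?L = "{es \<in> lists E. length es \<le> n}"
  let ?f = "\<lambda>g es. defect (adj (path_op S es) g)"
  define \<rho> where "\<rho> = Re (cinner (R g) g)"
  have \<rho>: "((\<lambda>e. (norm (adj (S e) g))\<^sup>2) has_sum \<rho>) E"
    unfolding \<rho>_def by (rule R_sum_norm)
  define s where "s e = (SOME s. (?f (adj (S e) g) has_sum s) ?L \<and>
      (1 - q ^ Suc n) * (norm (adj (S e) g))\<^sup>2 \<le> s \<and> s \<le> (norm (adj (S e) g))\<^sup>2)" for e
  have s: "(?f (adj (S e) g) has_sum s e) ?L"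
    and s_ge: "(1 - q ^ Suc n) * (norm (adj (S e) g))\<^sup>2 \<le> s e"
    and s_le: "s e \<le> (norm (adj (S e) g))\<^sup>2" for e
    using someI_ex[OF Suc.IH[of "adj (S e) g"]] unfolding s_def by blast+
  have s_nonneg: "0 \<le> s e" for e
    by (rule has_sum_nonneg[OF s]) (rule defect_nonneg)
  have s_sm: "s summable_on E"
    by (rule summable_on_comparison_test[OF has_sum_imp_summable[OF \<rho>]])
      (auto simp: s_nonneg s_le)
  then obtain t where t: "(s has_sum t) E" by (auto simp: summable_on_def)
  have t_le: "t \<le> \<rho>"
    by (rule has_sum_mono[OF t \<rho>]) (rule s_le)
  have t_ge: "(1 - q ^ Suc n) * \<rho> \<le> t"
    by (rule has_sum_mono[OF has_sum_cmult_right[OF \<rho>] t]) (rule s_ge)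
  let ?h = "\<lambda>(e, es). e # es"
  have "((\<lambda>(e, es). ?f (adj (S e) g) es) has_sum t) (E \<times> ?L)"
    by (rule has_sum_SigmaI[OF _ t]) (use s in \<open>auto intro!: summable_on_SigmaI[OF _ s_sm] defect_nonneg\<close>)
  then have "((?f g \<circ> ?h) has_sum t) (E \<times> ?L)"
    by (rule has_sum_cong[THEN iffD1, rotated]) (auto simp: adj_compose S_cbounded path_op_cbounded in_lists_conv_set subset_iff)
  then have "(?f g has_sum t) (?h ` (E \<times> ?L))"
    by (subst has_sum_reindex) (auto simp: inj_on_def)
  then have "(?f g has_sum (?f g [] + t)) (insert [] (?h ` (E \<times> ?L)))"
    by (intro has_sum_insert) auto
  then have "(?f g has_sum (defect g + t)) (insert [] (?h ` (E \<times> ?L)))"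
    by (simp add: adj_id_blinfun)
  moreover have "insert [] (?h ` (E \<times> ?L)) = {es \<in> lists E. length es \<le> Suc n}"
  proof (intro set_eqI)
    show "es \<in> insert [] (?h ` (E \<times> ?L)) \<longleftrightarrow> es \<in> {es \<in> lists E. length es \<le> Suc n}" for es
      by (cases es) (auto simp: image_iff)
  qed
  moreover have "defect g + t \<le> (norm g)\<^sup>2"
    using t_le by (simp add: defect_def \<rho>_def)
  moreover have "(1 - q ^ Suc (Suc n)) * (norm g)\<^sup>2 \<le> defect g + t"
  proof -
    have "q ^ Suc n * \<rho> \<le> q ^ Suc n * (q * (norm g)\<^sup>2)"
      unfolding \<rho>_def by (rule mult_left_mono[OF R_le]) (use q in simp)
    with t_ge show ?thesis
      by (simp add: defect_def \<rho>_def[symmetric] algebra_simps)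
  qed
  ultimately show ?case by auto
qed

text \<open>
  For a strict row contraction the part missed by the partial sums tends to zero. In operator terms,
  \<open>g \<mapsto> (D\<^sup>1\<^sup>/\<^sup>2 (adj (path_op S es) g))\<close>, indexed by words, is an isometry (the Poisson kernel).
\<close>

lemma poisson_lists: "((\<lambda>es. defect (adj (path_op S es) g)) has_sum (norm g)\<^sup>2) (lists E)"
proof -
  let ?f = "\<lambda>es. defect (adj (path_op S es) g)"
  have le: "sum ?f F \<le> (norm g)\<^sup>2" if F: "finite F" "F \<subseteq> lists E" for F
  proof -
    define n where "n = Max (length ` F)"
    obtain s where s: "(?f has_sum s) {es \<in> lists E. length es \<le> n}" "s \<le> (norm g)\<^sup>2"
      using poisson_partial by blast
    have "sum ?f F \<le> s"
      by (rule finite_sum_le_has_sum[OF s(1)]) (use F in \<open>auto simp: n_def defect_nonneg\<close>)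
    with s(2) show ?thesis by simp
  qed
  have "?f summable_on lists E"
    by (rule nonneg_bdd_above_summable_on) (auto simp: defect_nonneg intro!: bdd_aboveI le)
  then obtain t where t: "(?f has_sum t) (lists E)" by (auto simp: summable_on_def)
  have "t \<le> (norm g)\<^sup>2"
    by (rule has_sum_le_finite_sums[OF t le])
  moreover have "(norm g)\<^sup>2 \<le> t"
  proof -
    have "(1 - q ^ Suc n) * (norm g)\<^sup>2 \<le> t" for n
    proof -
      obtain s where s: "(?f has_sum s) {es \<in> lists E. length es \<le> n}"
        "(1 - q ^ Suc n) * (norm g)\<^sup>2 \<le> s"
        using poisson_partial by blast
      have "s \<le> t"
        by (rule has_sum_mono2[OF s(1) t]) (auto simp: defect_nonneg)
      with s(2) show ?thesis by linarith
    qed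
    moreover have "(\<lambda>n. (1 - q ^ Suc n) * (norm g)\<^sup>2) \<longlonglongrightarrow> (1 - 0) * (norm g)\<^sup>2"
      by (intro tendsto_intros LIMSEQ_Suc LIMSEQ_power_zero) (use q in simp)
    ultimately show ?thesis
      by (intro LIMSEQ_le_const2[where X = "\<lambda>n. (1 - q ^ Suc n) * (norm g)\<^sup>2"]) auto
  qed
  ultimately show ?thesis using t by simp
qed

end

section \<open>Generators of the quiver algebra\<close>

text \<open>
  A creation operator is a definite description. It denotes because prefixing an edge is injective on
  the words that fit, which gives existence, and because the basis spans a dense subspace, which gives uniqueness.
\<close>

lemma creation_basis:
  fixes \<xi> :: "('v, 'e) word \<Rightarrow> 'k::chilbert_space"
  assumes basis: "orthonormal_basis (free_semigroupoid G) \<xi>" and "e \<in> arcs G"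
  shows creation_cbounded: "creation G \<xi> e \<in> cbounded"
    and creation_apply: "w \<in> free_semigroupoid G \<Longrightarrow>
      creation G \<xi> e (\<xi> w) = (if rng G w = tail G e then \<xi> (concat_word (Path [e]) w) else 0)"
proof -
  let ?W = "free_semigroupoid G"
  let ?J = "{w \<in> ?W. rng G w = tail G e}"
  let ?s = "concat_word (Path [e])"
  have "?s w \<in> ?W" if "w \<in> ?J" for w
    using that \<open>e \<in> arcs G\<close>
    by (cases w) (auto simp: free_semigroupoid_def successively_Cons)
  then have s: "?s ` ?J \<subseteq> ?W" by blast
  have "inj_on ?s ?J"
  proof (rule inj_onI)
    fix v w assume "v \<in> ?J" "w \<in> ?J" "?s v = ?s w"
    then show "v = w"
      by (cases v; cases w) (auto simp: free_semigroupoid_def)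
  qed
  then obtain V :: "'k \<Rightarrow>\<^sub>L 'k" where V: "V \<in> cbounded"
    "\<And>w. w \<in> ?W \<Longrightarrow> V (\<xi> w) = (if w \<in> ?J then \<xi> (?s w) else 0)"
    using partial_shift_exists[OF basis _ s] by auto
  let ?P = "\<lambda>L :: 'k \<Rightarrow>\<^sub>L 'k. L \<in> cbounded \<and>
    (\<forall>w\<in>?W. L (\<xi> w) = (if rng G w = tail G e then \<xi> (?s w) else 0))"
  have "?P V" using V by auto
  moreover have "L = V" if "?P L" for L
    by (rule orthonormal_basis_eqI[OF basis]) (use that V in auto)
  ultimately have "?P (creation G \<xi> e)"
    unfolding creation_def by (rule theI)
  then show "creation G \<xi> e \<in> cbounded"
    and "w \<in> ?W \<Longrightarrow> creation G \<xi> e (\<xi> w) = (if rng G w = tail G e then \<xi> (?s w) else 0)"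
    by auto
qed

lemma projection_onto_eqI:
  fixes P :: "'a::chilbert_space \<Rightarrow>\<^sub>L 'a"
  assumes "\<And>x. P x \<in> M" and "\<And>x y. y \<in> M \<Longrightarrow> cinner (x - P x) y = 0"
  shows "projection_onto M = P"
  unfolding projection_onto_def
proof (rule the_equality)
  fix P' :: "'a \<Rightarrow>\<^sub>L 'a"
  assume P': "\<forall>x. P' x \<in> M \<and> (\<forall>y\<in>M. cinner (x - P' x) y = 0)"
  have "P' x = P x" for x
  proof -
    have orth: "cinner (P x - P' x) y = 0" if "y \<in> M" for y
    proof -
      have "cinner (P x - P' x) y = cinner (x - P' x) y - cinner (x - P x) y"
        by (simp add: cinner.diff_left)
      then show ?thesis
        using P' assms(2) that by simp
    qed
    have "cinner (P x - P' x) (P x - P' x) = 0"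
      using orth[of "P x"] orth[of "P' x"] P' assms(1) by (simp add: cinner.diff_right)
    then show ?thesis by (simp add: cinner_self)
  qed
  then show "P' = P" by (rule blinfun_eqI)
qed (use assms in blast)

text \<open>
  The diagonal operator that keeps the basis vectors of range \<open>x\<close> satisfies the characterisation of
  the orthogonal projection: both conditions hold on the basis and extend by density.
\<close>

lemma vertex_projection_basis:
  fixes \<xi> :: "('v, 'e) word \<Rightarrow> 'k::chilbert_space"
  assumes basis: "orthonormal_basis (free_semigroupoid G) \<xi>"
  shows vertex_projection_cbounded: "vertex_projection G \<xi> x \<in> cbounded"
    and vertex_projection_apply: "w \<in> free_semigroupoid G \<Longrightarrow>
      vertex_projection G \<xi> x (\<xi> w) = (if rng G w = x then \<xi> w else 0)"
proof -
  let ?W = "free_semigroupoid G"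
  let ?J = "{w \<in> ?W. rng G w = x}"
  let ?M = "closure (cspan (\<xi> ` ?J))"
  note total = basis[unfolded orthonormal_basis_def, THEN conjunct2]
  obtain P :: "'k \<Rightarrow>\<^sub>L 'k" where P: "P \<in> cbounded"
    "\<And>w. w \<in> ?W \<Longrightarrow> P (\<xi> w) = (if w \<in> ?J then \<xi> w else 0)"
    using partial_shift_exists[OF basis, of ?J "\<lambda>w. w"] by auto
  have span: "P y \<in> cspan (\<xi> ` ?J)" if "y \<in> cspan (\<xi> ` ?W)" for y
    using that
  proof (induction rule: complex_vector.span_induct_alt)
    case (step c y z)
    from step(1) obtain w where w: "w \<in> ?W" "y = \<xi> w" by blast
    have "P y \<in> cspan (\<xi> ` ?J)"
    proof (cases "rng G w = x")
      case True
      then have "\<xi> w \<in> cspan (\<xi> ` ?J)"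
        by (intro complex_vector.span_base) (use w in blast)
      then show ?thesis using True w by (simp add: P(2))
    next
      case False
      then show ?thesis using w by (simp add: P(2) complex_vector.span_zero)
    qed
    with step(2) show ?case
      by (simp add: blinfun.add_right cbounded_apply[OF P(1)] complex_vector.span_add
          complex_vector.span_scale)
  qed (simp add: complex_vector.span_zero)
  have "P ` closure (cspan (\<xi> ` ?W)) \<subseteq> ?M"
    by (rule image_closure_subset)
      (use span closure_subset in \<open>auto intro!: linear_continuous_on blinfun.bounded_linear_right\<close>)
  then have range: "P y \<in> ?M" for y
    using total by auto
  have orth: "cinner (z - P z) (\<xi> j) = 0" if "j \<in> ?J" for z j
  proof (rule bounded_linear_zero_closure[of "\<lambda>z. cinner (z - P z) (\<xi> j)" "\<xi> ` ?W"])
    show "bounded_linear (\<lambda>z. cinner (z - P z) (\<xi> j))"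
      by (intro bounded_linear_compose[OF cinner.bounded_linear_left] bounded_linear_sub
          bounded_linear_ident blinfun.bounded_linear_right)
    show "cinner (c *\<^sub>C y - P (c *\<^sub>C y)) (\<xi> j) = c *\<^sub>C cinner (y - P y) (\<xi> j)" for c y
      by (simp add: cbounded_apply[OF P(1)] scaleC_complex_def cinner.diff_left cinner_scaleC_left
          right_diff_distrib)
    show "cinner (y - P y) (\<xi> j) = 0" if "y \<in> \<xi> ` ?W" for y
      using that \<open>j \<in> ?J\<close> orthonormal_basis_orthonormal[OF basis]
      by (auto simp: P(2) cinner.zero_left)
    show "z \<in> closure (cspan (\<xi> ` ?W))" using total by simp
  qed
  have orth_M: "cinner y (z - P z) = 0" if "y \<in> ?M" for y z
  proof (rule bounded_linear_zero_closure[OF _ _ _ that])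
    show "bounded_linear (\<lambda>y. cinner y (z - P z))"
      by (rule cinner.bounded_linear_left)
    show "cinner (c *\<^sub>C y) (z - P z) = c *\<^sub>C cinner y (z - P z)" for c y
      by (simp add: scaleC_complex_def cinner_scaleC_left)
    show "cinner y (z - P z) = 0" if "y \<in> \<xi> ` ?J" for y
    proof -
      have "cinner (z - P z) y = 0" using that orth by blast
      then show ?thesis by (subst cinner_commute) simp
    qed
  qed
  have "cinner (z - P z) y = 0" if "y \<in> ?M" for y z
    using orth_M[OF that, of z] by (subst cinner_commute) simp
  then have "vertex_projection G \<xi> x = P"
    unfolding vertex_projection_def by (intro projection_onto_eqI range)
  with P show "vertex_projection G \<xi> x \<in> cbounded"
    and "w \<in> ?W \<Longrightarrow> vertex_projection G \<xi> x (\<xi> w) = (if rng G w = x then \<xi> w else 0)"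
    by auto
qed

section \<open>Intertwining\<close>

lemma blinfun_compose_assoc: "(A o\<^sub>L B) o\<^sub>L C = A o\<^sub>L (B o\<^sub>L C)"
  by (rule blinfun_eqI) simp

lemma blinfun_compose_id: "A o\<^sub>L id_blinfun = A"
  by (rule blinfun_eqI) simp

fun word_op :: "('v \<Rightarrow> 'h::chilbert_space \<Rightarrow>\<^sub>L 'h) \<Rightarrow> ('e \<Rightarrow> 'h \<Rightarrow>\<^sub>L 'h) \<Rightarrow> ('v, 'e) word \<Rightarrow> 'h \<Rightarrow>\<^sub>L 'h" where
  "word_op Q S (Vertex x) = Q x"
| "word_op Q S (Path es) = path_op S es"

text \<open>
  In the applications \<open>V\<close> sends a basis vector \<open>\<xi> w\<close> to the operator \<open>word_op Q S w\<close>. Evaluated at \<open>\<xi> w\<close>,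
  the relation then says that \<open>B o\<^sub>L word_op Q S w\<close> is the combination of the operators \<open>word_op Q S v\<close> with
  the coefficients of \<open>A (\<xi> w)\<close>: left multiplication by \<open>B\<close> acts on these operators as \<open>A\<close> acts on
  the basis vectors. Stated for all \<open>k\<close>, the relation is visibly compatible with
  composition, with no interchange of infinite sums.
\<close>

definition intertwined ::
    "('k::chilbert_space \<Rightarrow>\<^sub>L ('h::chilbert_space \<Rightarrow>\<^sub>L 'h)) \<Rightarrow> (('k \<Rightarrow>\<^sub>L 'k) \<times> ('h \<Rightarrow>\<^sub>L 'h)) set" where
  "intertwined V = {(A, B). A \<in> cbounded \<and> B \<in> cbounded \<and> (\<forall>k. B o\<^sub>L V k = V (A k))}"

lemma tendsto_adj_apply:
  assumes "(f \<longlongrightarrow> L) F" "L \<in> cbounded" "eventually (\<lambda>i. f i \<in> cbounded) F"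
  shows "((\<lambda>i. adj (f i) h) \<longlongrightarrow> adj L h) F"
proof (rule LIM_zero_cancel, rule Lim_null_comparison)
  show "eventually (\<lambda>i. norm (adj (f i) h - adj L h) \<le> norm (f i - L) * norm h) F"
    using assms(3)
  proof eventually_elim
    case (elim i)
    have "adj (f i) h - adj L h = adj (f i - L) h"
      using elim assms(2) by (simp add: adj_diff blinfun.diff_left)
    then show ?case
      using norm_adj_apply_le[OF cbounded_diff[OF elim assms(2)]] by simp
  qed
  have "((\<lambda>i. norm (f i - L) * norm h) \<longlongrightarrow> norm (L - L) * norm h) F"
    by (intro tendsto_intros assms)
  then show "((\<lambda>i. norm (f i - L) * norm h) \<longlongrightarrow> 0) F" by simp
qed

locale stabilized_strict_row_contraction =
  strict_row_contraction "arcs G" S R q + wf_digraph G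
  for G :: "('v, 'e) pre_digraph" and S :: "'e \<Rightarrow> 'h::chilbert_space \<Rightarrow>\<^sub>L 'h"
    and R :: "'h \<Rightarrow>\<^sub>L 'h" and q :: real +
  fixes Q :: "'v \<Rightarrow> 'h \<Rightarrow>\<^sub>L 'h"
  assumes stab: "stabilizes G Q S"
begin

lemma Q_cbounded: "x \<in> verts G \<Longrightarrow> Q x \<in> cbounded"
  and Q_idem: "x \<in> verts G \<Longrightarrow> Q x o\<^sub>L Q x = Q x"
  and Q_adj: "x \<in> verts G \<Longrightarrow> adj (Q x) = Q x"
  and Q_orth: "x \<in> verts G \<Longrightarrow> y \<in> verts G \<Longrightarrow> x \<noteq> y \<Longrightarrow> Q x o\<^sub>L Q y = 0"
  and Q_sum: "((\<lambda>x. Q x h) has_sum h) (verts G)"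
  and S_edge: "e \<in> arcs G \<Longrightarrow> Q (head G e) o\<^sub>L S e o\<^sub>L Q (tail G e) = S e"
  using stab by (auto simp: stabilizes_def is_projection_def has_strong_sum_def)

text \<open>
  Edges and vertices multiply in the image as they do in the graph: products of pieces that do not
  fit together vanish.
\<close>

lemma Q_S:
  assumes "e \<in> arcs G" "x \<in> verts G"
  shows "Q x o\<^sub>L S e = (if head G e = x then S e else 0)"
proof -
  have eq: "Q x o\<^sub>L S e = (Q x o\<^sub>L Q (head G e)) o\<^sub>L S e o\<^sub>L Q (tail G e)"
    by (subst S_edge[OF assms(1), symmetric]) (simp add: blinfun_compose_assoc)
  show ?thesis
    by (subst eq) (use assms in \<open>auto simp: Q_idem Q_orth S_edge\<close>)
qed

lemma S_Q:
  assumes "e \<in> arcs G" "x \<in> verts G"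
  shows "S e o\<^sub>L Q x = (if tail G e = x then S e else 0)"
proof -
  have eq: "S e o\<^sub>L Q x = Q (head G e) o\<^sub>L S e o\<^sub>L (Q (tail G e) o\<^sub>L Q x)"
    by (subst S_edge[OF assms(1), symmetric]) (simp add: blinfun_compose_assoc)
  show ?thesis
    by (subst eq) (use assms in \<open>auto simp: Q_idem Q_orth S_edge\<close>)
qed

lemma S_S_zero:
  assumes "e \<in> arcs G" "f \<in> arcs G" "tail G e \<noteq> head G f"
  shows "S e o\<^sub>L S f = 0"
proof -
  have "S e o\<^sub>L S f = (S e o\<^sub>L Q (head G f)) o\<^sub>L S f"
    using assms by (simp add: blinfun_compose_assoc Q_S)
  also have "\<dots> = 0"
    using assms by (simp add: S_Q)
  finally show ?thesis .
qed

lemma path_op_zero: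
  assumes "set es \<subseteq> arcs G" "\<not> successively (\<lambda>f e. tail G f = head G e) es"
  shows "path_op S es = 0"
  using assms
proof (induction es rule: induct_list012)
  case (3 e f es)
  show ?case
  proof (cases "tail G e = head G f")
    case True
    then show ?thesis using 3 by simp
  next
    case False
    then have "S e o\<^sub>L S f = 0" using 3 by (intro S_S_zero) auto
    then show ?thesis by (simp flip: blinfun_compose_assoc)
  qed
qed simp_all

lemma word_op_cbounded: "w \<in> free_semigroupoid G \<Longrightarrow> word_op Q S w \<in> cbounded"
  by (auto simp: free_semigroupoid_def Q_cbounded path_op_cbounded)

text \<open>Each term of the sum for \<open>R\<close> is either fixed or annihilated by \<open>Q x\<close>, on both sides alike.\<close>

lemma R_Q_commute:
  assumes x: "x \<in> verts G"
  shows "R (Q x y) = Q x (R y)"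
proof -
  have sum: "((\<lambda>e. S e (adj (S e) z)) has_sum R z) (arcs G)" for z
    using R_sum by (simp add: has_strong_sum_def)
  have "S e (adj (S e) (Q x y)) = Q x (S e (adj (S e) y))" if e: "e \<in> arcs G" for e
  proof -
    have "adj (S e) (Q x y) = adj (Q x o\<^sub>L S e) y"
      using e x by (simp add: adj_compose Q_cbounded S_cbounded Q_adj)
    moreover have "Q x (S e (adj (S e) y)) = (Q x o\<^sub>L S e) (adj (S e) y)" by simp
    ultimately show ?thesis
      using e x by (simp only: Q_S) (simp add: adj_zero)
  qed
  then have "((\<lambda>e. Q x (S e (adj (S e) y))) has_sum R (Q x y)) (arcs G)"
    using sum[of "Q x y"] by (subst has_sum_cong) auto
  moreover have "((\<lambda>e. Q x (S e (adj (S e) y))) has_sum Q x (R y)) (arcs G)"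
    by (rule has_sum_bounded_linear[OF blinfun.bounded_linear_right sum])
  ultimately show ?thesis by (rule has_sum_unique)
qed

lemma defect_vertices: "((\<lambda>x. defect (adj (Q x) g)) has_sum defect g) (verts G)"
proof -
  have eq: "Re (cinner (Q x (g - R g)) g) = defect (adj (Q x) g)" if x: "x \<in> verts G" for x
  proof -
    have idem: "Q x (Q x y) = Q x y" for y
      using Q_idem[OF x] by (metis blinfun_apply_blinfun_compose)
    have self: "cinner y (Q x z) = cinner (Q x y) z" for y z
      using cinner_adj_right[OF Q_cbounded[OF x]] by (simp add: Q_adj x)
    have "defect (adj (Q x) g) = Re (cinner (Q x g) (Q x g)) - Re (cinner (R (Q x g)) (Q x g))"
      by (simp add: defect_def Q_adj x cinner_self del: of_real_power)
    then show ?thesis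
      by (simp add: self R_Q_commute x idem blinfun.diff_right cinner.diff_left)
  qed
  have "((\<lambda>x. Re (cinner (Q x (g - R g)) g)) has_sum Re (cinner (g - R g) g)) (verts G)"
    by (intro has_sum_Re has_sum_cinner_left Q_sum)
  moreover have "Re (cinner (g - R g) g) = defect g"
    by (simp add: defect_def cinner.diff_left cinner_self del: of_real_power)
  ultimately show ?thesis
    by (subst (asm) has_sum_cong[OF eq]) simp_all
qed

text \<open>
  The identity for all lists of edges becomes one for paths of the graph: lists that are not paths
  contribute zero, and the contribution of the empty list, which is no path, is shared out among the
  vertices.
\<close>

lemma poisson_words:
  "((\<lambda>w. defect (adj (word_op Q S w) g)) has_sum (norm g)\<^sup>2) (free_semigroupoid G)"
proof -
  let ?f = "\<lambda>es. defect (adj (path_op S es) g)"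
  let ?W = "\<lambda>w. defect (adj (word_op Q S w) g)"
  let ?P = "{es. es \<noteq> [] \<and> set es \<subseteq> arcs G \<and> successively (\<lambda>f e. tail G f = head G e) es}"
  have "(?f has_sum ((norm g)\<^sup>2 - defect g)) (lists (arcs G) - {[]})"
    by (rule has_sum_Diff[OF poisson_lists]) (auto intro!: has_sum_finiteI simp: adj_id_blinfun)
  then have "(?f has_sum ((norm g)\<^sup>2 - defect g)) ?P"
    by (rule has_sum_cong_neutral[THEN iffD1, rotated -1])
      (auto simp: path_op_zero subset_iff adj_zero defect_def cinner.zero_left)
  then have paths: "(?W has_sum ((norm g)\<^sup>2 - defect g)) (Path ` ?P)"
    by (subst has_sum_reindex) (auto simp: inj_on_def o_def)
  have "(?W has_sum defect g) (Vertex ` verts G)"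
    using defect_vertices[of g] by (subst has_sum_reindex) (auto simp: inj_on_def o_def)
  from has_sum_Un_disjoint[OF this paths]
  have "(?W has_sum (norm g)\<^sup>2) (Vertex ` verts G \<union> Path ` ?P)" by auto
  moreover have "free_semigroupoid G = Vertex ` verts G \<union> Path ` ?P"
    by (auto simp: free_semigroupoid_def)
  ultimately show ?thesis by simp
qed

text \<open>
  Strictness bounds \<open>\<parallel>x\<parallel>\<^sup>2\<close> by a multiple of \<open>defect x\<close>, so the column of all
  \<open>adj (word_op Q S w)\<close> is bounded; this makes the sums that define the symbol map converge in norm.
\<close>

lemma sum_norm_words_le:
  assumes "finite F" "F \<subseteq> free_semigroupoid G"
  shows "(\<Sum>w\<in>F. (norm (adj (word_op Q S w) g))\<^sup>2) \<le> (norm g)\<^sup>2 / (1 - q)"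
proof -
  have "(1 - q) * (\<Sum>w\<in>F. (norm (adj (word_op Q S w) g))\<^sup>2) \<le> (\<Sum>w\<in>F. defect (adj (word_op Q S w) g))"
    unfolding sum_distrib_left by (intro sum_mono defect_ge)
  also have "\<dots> \<le> (norm g)\<^sup>2"
    by (rule finite_sum_le_has_sum[OF poisson_words]) (use assms in \<open>auto simp: defect_nonneg\<close>)
  finally show ?thesis
    using q by (simp add: field_simps)
qed

lemma symbol_exists:
  fixes \<xi> :: "('v, 'e) word \<Rightarrow> 'k::chilbert_space"
  assumes basis: "orthonormal_basis (free_semigroupoid G) \<xi>"
  obtains V :: "'k \<Rightarrow>\<^sub>L ('h \<Rightarrow>\<^sub>L 'h)" where "V \<in> cbounded"
    and "\<And>k. ((\<lambda>w. cinner k (\<xi> w) *\<^sub>C word_op Q S w) has_sum V k) (free_semigroupoid G)"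
    and "\<And>w. w \<in> free_semigroupoid G \<Longrightarrow> V (\<xi> w) = word_op Q S w"
proof (rule orthonormal_extension[where b = \<xi> and I = "free_semigroupoid G" and C = "1 / sqrt (1 - q)"
      and v = "word_op Q S"])
  show "cinner (\<xi> v) (\<xi> w) = (if v = w then 1 else 0)"
    if "v \<in> free_semigroupoid G" "w \<in> free_semigroupoid G" for v w
    using orthonormal_basis_orthonormal[OF basis] that by blast
  fix F c assume F: "finite F" "F \<subseteq> free_semigroupoid G"
  let ?B = "\<Sum>w\<in>F. c w *\<^sub>C word_op Q S w"
  have cb: "c w *\<^sub>C word_op Q S w \<in> cbounded" if "w \<in> F" for w
    using that F by (auto intro: cbounded_scaleC word_op_cbounded)
  show "norm ?B \<le> 1 / sqrt (1 - q) * sqrt (\<Sum>w\<in>F. (cmod (c w))\<^sup>2)"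
  proof (rule norm_le_of_adj_apply_le)
    show "?B \<in> cbounded" using cb by (rule cbounded_sum)
    show "0 \<le> 1 / sqrt (1 - q) * sqrt (\<Sum>w\<in>F. (cmod (c w))\<^sup>2)"
      using q by (simp add: sum_nonneg)
    fix y
    have "adj ?B y = (\<Sum>w\<in>F. cnj (c w) *\<^sub>C adj (word_op Q S w) y)"
      using F by (simp add: adj_sum[OF cb] blinfun.sum_left adj_scaleC word_op_cbounded subset_iff
          scaleC_blinfun.rep_eq)
    also have "norm \<dots> \<le> (\<Sum>w\<in>F. \<bar>cmod (c w)\<bar> * \<bar>norm (adj (word_op Q S w) y)\<bar>)"
      by (rule order_trans[OF norm_sum]) (simp add: norm_scaleC)
    also have "\<dots> \<le> L2_set (\<lambda>w. cmod (c w)) F * L2_set (\<lambda>w. norm (adj (word_op Q S w) y)) F"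
      by (rule L2_set_mult_ineq)
    also have "\<dots> \<le> L2_set (\<lambda>w. cmod (c w)) F * (norm y / sqrt (1 - q))"
      unfolding L2_set_def[of "\<lambda>w. norm (adj (word_op Q S w) y)"]
      using sum_norm_words_le[OF F, of y] q
      by (intro mult_left_mono real_le_lsqrt) (auto simp: power_divide sum_nonneg)
    finally show "norm (adj ?B y) \<le> 1 / sqrt (1 - q) * sqrt (\<Sum>w\<in>F. (cmod (c w))\<^sup>2) * norm y"
      by (simp add: L2_set_def mult_ac)
  qed
qed (use that q in auto)

text \<open>
  By the Poisson identity at \<open>adj B h\<close> and at \<open>h\<close>, the claim compares two sums of defects; the
  intertwining relation expresses the vectors of the first sum through those of the second by the
  conjugated matrix of \<open>A\<close>, so that \<open>amplification_bound\<close> applies to all finite sections.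
\<close>

lemma intertwined_contractive:
  fixes \<xi> :: "('v, 'e) word \<Rightarrow> 'k::chilbert_space" and V :: "'k \<Rightarrow>\<^sub>L ('h \<Rightarrow>\<^sub>L 'h)"
  assumes basis: "orthonormal_basis (free_semigroupoid G) \<xi>"
    and V_sum: "\<And>k. ((\<lambda>w. cinner k (\<xi> w) *\<^sub>C word_op Q S w) has_sum V k) (free_semigroupoid G)"
    and V_basis: "\<And>w. w \<in> free_semigroupoid G \<Longrightarrow> V (\<xi> w) = word_op Q S w"
    and AB: "(A, B) \<in> intertwined V"
  shows "norm B \<le> norm A"
proof -
  let ?W = "free_semigroupoid G"
  have A: "A \<in> cbounded" and B: "B \<in> cbounded" and BV: "\<And>k. B o\<^sub>L V k = V (A k)"
    using AB by (auto simp: intertwined_def)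
  have defect_D: "defect x = Re (cinner ((id_blinfun - R) x) x)" for x
    by (simp add: defect_def blinfun.diff_left cinner.diff_left cinner_self del: of_real_power)
  have defect_tendsto: "((\<lambda>i. defect (f i)) \<longlongrightarrow> defect l) F" if "(f \<longlongrightarrow> l) F"
    for f l and F :: "('v, 'e) word set filter"
    unfolding defect_def using that
    by (intro tendsto_intros tendsto_Re cinner.tendsto blinfun.tendsto)
  have "norm (adj B h) \<le> norm A * norm h" for h
  proof (rule power2_le_imp_le)
    show "(norm (adj B h))\<^sup>2 \<le> (norm A * norm h)\<^sup>2"
    proof (rule has_sum_le_finite_sums[OF poisson_words])
      fix F assume F: "finite F" "F \<subseteq> ?W"
      define a where "a v w = cinner (A (\<xi> w)) (\<xi> v)" for v w
      define x where "x v = adj (word_op Q S v) h" for v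
      have adj_B: "adj (word_op Q S w) (adj B h) = adj (V (A (\<xi> w))) h" if "w \<in> F" for w
      proof -
        have "w \<in> ?W" using that F by auto
        then have "adj (word_op Q S w) (adj B h) = adj (B o\<^sub>L V (\<xi> w)) h"
          by (simp add: adj_compose B V_basis word_op_cbounded)
        then show ?thesis by (simp add: BV)
      qed
      have section_eq: "adj (\<Sum>v\<in>E. a v w *\<^sub>C word_op Q S v) h = (\<Sum>v\<in>E. cnj (a v w) *\<^sub>C x v)"
        if "E \<subseteq> ?W" for E w
        using that by (subst adj_sum)
          (auto simp: blinfun.sum_left adj_scaleC word_op_cbounded cbounded_scaleC subset_iff
            scaleC_blinfun.rep_eq x_def intro!: sum.cong)
      have "(\<Sum>w\<in>F. defect (\<Sum>v\<in>E. cnj (a v w) *\<^sub>C x v)) \<le> (norm A * norm h)\<^sup>2"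
        if E: "finite E" "E \<subseteq> ?W" for E
      proof -
        have "(\<Sum>w\<in>F. defect (\<Sum>v\<in>E. cnj (a v w) *\<^sub>C x v)) \<le> (norm A)\<^sup>2 * (\<Sum>v\<in>E. defect (x v))"
          unfolding defect_D
        proof (rule amplification_bound[OF E(1)])
          show "id_blinfun - R \<in> cbounded"
            by (intro cbounded_diff cbounded_id_blinfun R_cbounded)
          show "cinner ((id_blinfun - R) y) z = cinner y ((id_blinfun - R) z)" for y z
            by (simp add: blinfun.diff_left cinner.diff_left cinner.diff_right R_hermitian)
          show "0 \<le> Re (cinner ((id_blinfun - R) y) y)" for y
            using defect_nonneg[of y] by (simp add: defect_D)
          fix y :: "('v, 'e) word \<Rightarrow> complex"
          define Y where "Y = (\<Sum>v\<in>E. cnj (y v) *\<^sub>C \<xi> v)"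
          have "(\<Sum>v\<in>E. y v * a v w) = cinner (A (\<xi> w)) Y" for w
            by (simp add: Y_def a_def cinner.sum_right cinner_scaleC_right)
          moreover have "cmod (cinner (A (\<xi> w)) Y) = cmod (cinner (adj A Y) (\<xi> w))" for w
            using cinner_adj_left[OF A, of Y "\<xi> w"] by (metis cinner_commute complex_mod_cnj)
          ultimately have "(\<Sum>w\<in>F. (cmod (\<Sum>v\<in>E. y v * a v w))\<^sup>2)
              = (\<Sum>w\<in>F. (cmod (cinner (adj A Y) (\<xi> w)))\<^sup>2)" by simp
          also have "\<dots> \<le> (norm (adj A Y))\<^sup>2"
            by (rule bessel_inequality)
              (use F orthonormal_basis_orthonormal[OF basis] in blast)+
          also have "\<dots> \<le> (norm A * norm Y)\<^sup>2"
            by (intro power_mono norm_adj_apply_le A) simp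
          also have "(norm Y)\<^sup>2 = (\<Sum>v\<in>E. (cmod (cnj (y v)))\<^sup>2)"
            unfolding Y_def by (rule norm_orthonormal_sum)
              (use E orthonormal_basis_orthonormal[OF basis] in blast)+
          then have "(norm A * norm Y)\<^sup>2 = (norm A)\<^sup>2 * (\<Sum>v\<in>E. (cmod (y v))\<^sup>2)"
            by (simp add: power_mult_distrib)
          finally show "(\<Sum>w\<in>F. (cmod (\<Sum>v\<in>E. y v * a v w))\<^sup>2) \<le> (norm A)\<^sup>2 * (\<Sum>v\<in>E. (cmod (y v))\<^sup>2)" .
        qed
        also have "(\<Sum>v\<in>E. defect (x v)) \<le> (norm h)\<^sup>2"
          unfolding x_def
          by (rule finite_sum_le_has_sum[OF poisson_words]) (use E in \<open>auto simp: defect_nonneg\<close>)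
        then have "(norm A)\<^sup>2 * (\<Sum>v\<in>E. defect (x v)) \<le> (norm A * norm h)\<^sup>2"
          by (simp add: power_mult_distrib mult_left_mono)
        finally show ?thesis .
      qed
      then have ev: "eventually (\<lambda>E. (\<Sum>w\<in>F. defect (\<Sum>v\<in>E. cnj (a v w) *\<^sub>C x v)) \<le> (norm A * norm h)\<^sup>2)
          (finite_subsets_at_top ?W)"
        by (rule eventually_finite_subsets_at_top_weakI)
      \<comment> \<open>As the section \<open>E\<close> grows, the truncated vectors converge to those for \<open>adj B h\<close>.\<close>
      have "((\<lambda>E. \<Sum>w\<in>F. defect (\<Sum>v\<in>E. cnj (a v w) *\<^sub>C x v))
          \<longlongrightarrow> (\<Sum>w\<in>F. defect (adj (word_op Q S w) (adj B h)))) (finite_subsets_at_top ?W)"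
      proof (intro tendsto_sum defect_tendsto)
        fix w assume w: "w \<in> F"
        have ev_cb: "eventually (\<lambda>E. (\<Sum>v\<in>E. a v w *\<^sub>C word_op Q S v) \<in> cbounded) (finite_subsets_at_top ?W)"
          by (rule eventually_finite_subsets_at_top_weakI)
            (auto intro!: cbounded_sum cbounded_scaleC word_op_cbounded)
        have "((\<lambda>E. \<Sum>v\<in>E. a v w *\<^sub>C word_op Q S v) \<longlongrightarrow> V (A (\<xi> w))) (finite_subsets_at_top ?W)"
          using V_sum[of "A (\<xi> w)"] by (simp add: has_sum_def a_def)
        moreover have "V (A (\<xi> w)) \<in> cbounded"
          by (rule Lim_in_closed_set[OF closed_cbounded ev_cb _ calculation]) simp
        ultimately have "((\<lambda>E. adj (\<Sum>v\<in>E. a v w *\<^sub>C word_op Q S v) h) \<longlongrightarrow> adj (V (A (\<xi> w))) h)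
            (finite_subsets_at_top ?W)"
          by (rule tendsto_adj_apply) (rule ev_cb)
        then show "((\<lambda>E. \<Sum>v\<in>E. cnj (a v w) *\<^sub>C x v) \<longlongrightarrow> adj (word_op Q S w) (adj B h))
            (finite_subsets_at_top ?W)"
          unfolding adj_B[OF w]
          by (rule Lim_transform_eventually)
            (intro eventually_finite_subsets_at_top_weakI section_eq)
      qed
      then show "(\<Sum>w\<in>F. defect (adj (word_op Q S w) (adj B h))) \<le> (norm A * norm h)\<^sup>2"
        by (rule tendsto_upperbound[OF _ ev]) simp
    qed
  qed simp
  then show ?thesis
    by (intro norm_le_of_adj_apply_le B) auto
qed

lemma intertwinedI:
  fixes \<xi> :: "('v, 'e) word \<Rightarrow> 'k::chilbert_space" and V :: "'k \<Rightarrow>\<^sub>L ('h \<Rightarrow>\<^sub>L 'h)"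
  assumes basis: "orthonormal_basis (free_semigroupoid G) \<xi>" and V: "V \<in> cbounded"
    and A: "A \<in> cbounded" and B: "B \<in> cbounded"
    and eq: "\<And>w. w \<in> free_semigroupoid G \<Longrightarrow> B o\<^sub>L V (\<xi> w) = V (A (\<xi> w))"
  shows "(A, B) \<in> intertwined V"
proof -
  have "(B o\<^sub>L V k) - V (A k) = 0" for k
  proof (rule bounded_linear_zero_closure[of "\<lambda>k. (B o\<^sub>L V k) - V (A k)" "\<xi> ` free_semigroupoid G"])
    show "bounded_linear (\<lambda>k. (B o\<^sub>L V k) - V (A k))"
      by (intro bounded_linear_sub bounded_linear_intros
          bounded_linear_compose[OF bounded_bilinear.bounded_linear_right[OF bounded_bilinear_blinfun_compose]]
          bounded_linear_compose[OF blinfun.bounded_linear_right])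
    show "(B o\<^sub>L V (c *\<^sub>C x)) - V (A (c *\<^sub>C x)) = c *\<^sub>C ((B o\<^sub>L V x) - V (A x))" for c x
      by (rule blinfun_eqI) (simp add: cbounded_apply[OF V] cbounded_apply[OF A] cbounded_apply[OF B]
          blinfun.diff_left scaleC_blinfun.rep_eq complex_vector.scale_right_diff_distrib)
    show "k \<in> closure (cspan (\<xi> ` free_semigroupoid G))"
      using basis by (simp add: orthonormal_basis_def)
  qed (use eq in auto)
  then show ?thesis
    using A B by (auto simp: intertwined_def)
qed

lemma creation_intertwined:
  fixes \<xi> :: "('v, 'e) word \<Rightarrow> 'k::chilbert_space" and V :: "'k \<Rightarrow>\<^sub>L ('h \<Rightarrow>\<^sub>L 'h)"
  assumes basis: "orthonormal_basis (free_semigroupoid G) \<xi>" and V: "V \<in> cbounded"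
    and V_basis: "\<And>w. w \<in> free_semigroupoid G \<Longrightarrow> V (\<xi> w) = word_op Q S w"
    and e: "e \<in> arcs G"
  shows "(creation G \<xi> e, S e) \<in> intertwined V"
proof (rule intertwinedI[OF basis V creation_cbounded[OF basis e] S_cbounded[OF e]])
  fix w assume w: "w \<in> free_semigroupoid G"
  show "S e o\<^sub>L V (\<xi> w) = V (creation G \<xi> e (\<xi> w))"
  proof (cases "rng G w = tail G e")
    case True
    have "concat_word (Path [e]) w \<in> free_semigroupoid G"
      using True w e by (cases w) (auto simp: free_semigroupoid_def successively_Cons)
    moreover have "S e o\<^sub>L word_op Q S w = word_op Q S (concat_word (Path [e]) w)"
      using True w e by (cases w) (auto simp: S_Q blinfun_compose_id free_semigroupoid_def)
    ultimately show ?thesis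
      using w True by (simp add: creation_apply[OF basis e] V_basis)
  next
    case False
    have "S e o\<^sub>L word_op Q S w = 0"
    proof (cases w)
      case (Vertex x)
      then show ?thesis using w e False by (auto simp: S_Q free_semigroupoid_def)
    next
      case (Path es)
      then obtain f fs where "es = f # fs" "f \<in> arcs G" "head G f \<noteq> tail G e"
        using w False by (cases es) (auto simp: free_semigroupoid_def)
      then show ?thesis
        using Path e by (simp add: S_S_zero flip: blinfun_compose_assoc)
    qed
    then show ?thesis
      using w False by (simp add: creation_apply[OF basis e] V_basis)
  qed
qed

lemma vertex_projection_intertwined:
  fixes \<xi> :: "('v, 'e) word \<Rightarrow> 'k::chilbert_space" and V :: "'k \<Rightarrow>\<^sub>L ('h \<Rightarrow>\<^sub>L 'h)"
  assumes basis: "orthonormal_basis (free_semigroupoid G) \<xi>" and V: "V \<in> cbounded"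
    and V_basis: "\<And>w. w \<in> free_semigroupoid G \<Longrightarrow> V (\<xi> w) = word_op Q S w"
    and x: "x \<in> verts G"
  shows "(vertex_projection G \<xi> x, Q x) \<in> intertwined V"
proof (rule intertwinedI[OF basis V vertex_projection_cbounded[OF basis] Q_cbounded[OF x]])
  fix w assume w: "w \<in> free_semigroupoid G"
  have "Q x o\<^sub>L word_op Q S w = (if rng G w = x then word_op Q S w else 0)"
  proof (cases w)
    case (Vertex y)
    then show ?thesis using w x by (auto simp: Q_idem Q_orth free_semigroupoid_def)
  next
    case (Path es)
    then obtain f fs where "es = f # fs" "f \<in> arcs G"
      using w by (cases es) (auto simp: free_semigroupoid_def)
    then show ?thesis
      using Path x by (simp add: Q_S flip: blinfun_compose_assoc)
  qed
  then show "Q x o\<^sub>L V (\<xi> w) = V (vertex_projection G \<xi> x (\<xi> w))"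
    using w by (simp add: vertex_projection_apply[OF basis] V_basis)
qed

end

section \<open>Graphs of contractive homomorphisms\<close>

text \<open>
  A homomorphism is handled as its graph: the generators determine it on an algebra that has no
  explicit description, while passing to limits in the homomorphism or in its domain is an operation
  on sets of pairs. Single-valuedness is a consequence of contractivity and linearity.
\<close>

locale contractive_hom_graph =
  fixes C :: "(('a::chilbert_space \<Rightarrow>\<^sub>L 'a) \<times> ('b::chilbert_space \<Rightarrow>\<^sub>L 'b)) set"
  assumes zero: "(0, 0) \<in> C"
    and add: "(A, B) \<in> C \<Longrightarrow> (A', B') \<in> C \<Longrightarrow> (A + A', B + B') \<in> C"
    and scale: "(A, B) \<in> C \<Longrightarrow> (c *\<^sub>C A, c *\<^sub>C B) \<in> C"
    and compose: "(A, B) \<in> C \<Longrightarrow> (A', B') \<in> C \<Longrightarrow> (A o\<^sub>L A', B o\<^sub>L B') \<in> C"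
    and cbounded: "(A, B) \<in> C \<Longrightarrow> B \<in> cbounded"
    and contractive: "(A, B) \<in> C \<Longrightarrow> norm B \<le> norm A"
begin

lemma diff:
  assumes "(A, B) \<in> C" "(A', B') \<in> C"
  shows "(A - A', B - B') \<in> C"
  using add[OF assms(1) scale[OF assms(2), of "-1"]] by (simp add: scaleC_one)

lemma single_valued:
  assumes "(A, B) \<in> C" "(A, B') \<in> C"
  shows "B = B'"
  using contractive[OF diff[OF assms]] by simp

lemma contractive_hom_graph_closure: "contractive_hom_graph (closure C)"
proof
  have seq: "\<exists>X Y. (\<forall>n. (X n, Y n) \<in> C) \<and> X \<longlonglongrightarrow> A \<and> Y \<longlonglongrightarrow> B" if "(A, B) \<in> closure C" for A B
  proof -
    obtain Z where "\<forall>n. Z n \<in> C" "Z \<longlonglongrightarrow> (A, B)"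
      using \<open>(A, B) \<in> closure C\<close> unfolding closure_sequential by blast
    then show ?thesis
      using tendsto_fst[of Z "(A, B)"] tendsto_snd[of Z "(A, B)"]
      by (intro exI[of _ "\<lambda>n. fst (Z n)"] exI[of _ "\<lambda>n. snd (Z n)"]) simp
  qed
  have lim: "(A, B) \<in> closure C" if "\<And>n. (X n, Y n) \<in> C" "X \<longlonglongrightarrow> A" "Y \<longlonglongrightarrow> B" for X Y A B
    unfolding closure_sequential using that
    by (intro exI[of _ "\<lambda>n. (X n, Y n)"]) (auto intro: tendsto_Pair)
  show "(0, 0) \<in> closure C"
    using zero closure_subset by blast
  fix A B assume "(A, B) \<in> closure C"
  then obtain X Y where XY: "\<And>n. (X n, Y n) \<in> C" "X \<longlonglongrightarrow> A" "Y \<longlonglongrightarrow> B"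
    using seq by blast
  show "(c *\<^sub>C A, c *\<^sub>C B) \<in> closure C" for c
    by (rule lim[where X = "\<lambda>n. c *\<^sub>C X n" and Y = "\<lambda>n. c *\<^sub>C Y n"];
        intro scale XY(1) bounded_linear.tendsto[OF bounded_linear_scaleC] XY)
  show "B \<in> cbounded"
    by (rule closed_sequentially[OF closed_cbounded cbounded[OF XY(1)] XY(3)])
  show "norm B \<le> norm A"
    by (rule LIMSEQ_le[OF tendsto_norm[OF XY(3)] tendsto_norm[OF XY(2)]]) (use contractive XY(1) in blast)
  fix A' B' assume "(A', B') \<in> closure C"
  then obtain X' Y' where XY': "\<And>n. (X' n, Y' n) \<in> C" "X' \<longlonglongrightarrow> A'" "Y' \<longlonglongrightarrow> B'"
    using seq by blast
  show "(A + A', B + B') \<in> closure C"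
    by (rule lim[where X = "\<lambda>n. X n + X' n" and Y = "\<lambda>n. Y n + Y' n"]; intro add tendsto_add XY XY')
  show "(A o\<^sub>L A', B o\<^sub>L B') \<in> closure C"
    by (rule lim[where X = "\<lambda>n. X n o\<^sub>L X' n" and Y = "\<lambda>n. Y n o\<^sub>L Y' n"];
        intro compose bounded_bilinear.tendsto[OF bounded_bilinear_blinfun_compose] XY XY')
qed

text \<open>If \<open>X n\<close> converges, then so do the values at \<open>X n\<close>, because they form a Cauchy sequence.\<close>

lemma closed_domain:
  assumes "closed C"
  shows "closed (fst ` C)"
  unfolding closed_sequential_limits
proof (intro allI impI, elim conjE)
  fix X A assume X: "\<forall>n. X n \<in> fst ` C" and A: "X \<longlonglongrightarrow> A"
  then have "\<forall>n. \<exists>B. (X n, B) \<in> C" by force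
  then obtain Y where Y: "\<And>n. (X n, Y n) \<in> C" by metis
  have "Cauchy Y"
  proof (rule metric_CauchyI)
    fix e :: real assume "e > 0"
    then obtain N where N: "\<forall>m\<ge>N. \<forall>n\<ge>N. dist (X m) (X n) < e"
      using LIMSEQ_imp_Cauchy[OF A] metric_CauchyD by blast
    have "dist (Y m) (Y n) \<le> dist (X m) (X n)" for m n
      unfolding dist_norm by (rule contractive[OF diff[OF Y Y]])
    with N show "\<exists>N. \<forall>m\<ge>N. \<forall>n\<ge>N. dist (Y m) (Y n) < e"
      by (meson le_less_trans)
  qed
  then obtain B where "Y \<longlonglongrightarrow> B"
    by (metis Cauchy_convergent convergent_def)
  then have "(A, B) \<in> C"
    using closed_sequentially[OF assms Y tendsto_Pair[OF A]] by blast
  then show "A \<in> fst ` C" by force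
qed

lemma extends_to_hull_if_closed:
  assumes "closed C" "P \<subseteq> C"
  shows "\<exists>\<Psi>. algebra_hom ((\<lambda>X. subalgebra X \<and> closed X) hull (fst ` P)) \<Psi> \<and>
    (\<forall>A\<in>(\<lambda>X. subalgebra X \<and> closed X) hull (fst ` P). norm (\<Psi> A) \<le> norm A) \<and>
    (\<forall>(A, B)\<in>P. \<Psi> A = B)"
proof -
  let ?H = "(\<lambda>X. subalgebra X \<and> closed X) hull (fst ` P)"
  define \<Psi> where "\<Psi> A = (THE B. (A, B) \<in> C)" for A
  have \<Psi>: "\<Psi> A = B" if "(A, B) \<in> C" for A B
    unfolding \<Psi>_def using that single_valued by blast
  have "subalgebra (fst ` C)"
    unfolding subalgebra_def
  proof (intro conjI ballI allI)
    have domI: "A \<in> fst ` C" if "(A, B) \<in> C" for A B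
      using that by (rule image_eqI[rotated]) simp
    show "0 \<in> fst ` C" by (rule domI[OF zero])
    fix A assume "A \<in> fst ` C"
    then obtain B where B: "(A, B) \<in> C" by auto
    show "c *\<^sub>C A \<in> fst ` C" for c by (rule domI[OF scale[OF B]])
    fix A' assume "A' \<in> fst ` C"
    then obtain B' where B': "(A', B') \<in> C" by auto
    show "A + A' \<in> fst ` C" by (rule domI[OF add[OF B B']])
    show "A o\<^sub>L A' \<in> fst ` C" by (rule domI[OF compose[OF B B']])
  qed
  then have "?H \<subseteq> fst ` C"
    using assms(2) closed_domain[OF assms(1)] by (intro hull_minimal) auto
  then have in_C: "(A, \<Psi> A) \<in> C" if "A \<in> ?H" for A
    using that \<Psi> by force
  have "algebra_hom ?H \<Psi>"
    unfolding algebra_hom_def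
    by (intro conjI ballI allI \<Psi> add scale compose cbounded[OF in_C] in_C)
  moreover have "\<forall>A\<in>?H. norm (\<Psi> A) \<le> norm A"
    using contractive[OF in_C] by blast
  moreover have "\<forall>(A, B)\<in>P. \<Psi> A = B"
    using \<Psi> assms(2) by blast
  ultimately show ?thesis by blast
qed

end

text \<open>
  A contractive graph stays contractive under closure, and the domain of a closed one is closed;
  this is the extension of a contractive homomorphism by continuity.
\<close>

lemma contractive_hom_graph_extends_to_hull:
  assumes "contractive_hom_graph C" "P \<subseteq> C"
  shows "\<exists>\<Psi>. algebra_hom ((\<lambda>X. subalgebra X \<and> closed X) hull (fst ` P)) \<Psi> \<and>
    (\<forall>A\<in>(\<lambda>X. subalgebra X \<and> closed X) hull (fst ` P). norm (\<Psi> A) \<le> norm A) \<and>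
    (\<forall>(A, B)\<in>P. \<Psi> A = B)"
  using assms closure_subset[of C]
  by (intro contractive_hom_graph.extends_to_hull_if_closed[where C = "closure C"]
      contractive_hom_graph.contractive_hom_graph_closure) auto

text \<open>
  The relation \<open>C r\<close> will belong to the strict row contraction \<open>r *\<^sub>R T\<close>, and the images of a fixed
  operator \<open>A\<close> under these relations converge to the image of \<open>A\<close> under the relation for \<open>T\<close>. Only
  those \<open>A\<close> are kept for which this limit exists in norm; they form an algebra that contains the
  generators.
\<close>

definition radial_limits ::
    "(real \<Rightarrow> ('a::topological_space \<times> 'b::topological_space) set) \<Rightarrow> ('a \<times> 'b) set" where
  "radial_limits C = {(A, B). \<exists>f. (\<forall>r. 0 < r \<and> r < 1 \<longrightarrow> (A, f r) \<in> C r) \<and> (f \<longlongrightarrow> B) (at_left 1)}"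

lemma contractive_hom_graph_radial_limits:
  assumes C: "\<And>r. 0 < r \<Longrightarrow> r < 1 \<Longrightarrow> contractive_hom_graph (C r)"
  shows "contractive_hom_graph (radial_limits C)"
proof
  \<comment> \<open>Every requirement passes from \<open>f r\<close> to the limit, by continuity of the operation involved.\<close>
  have ev: "eventually (\<lambda>r. 0 < r \<and> r < 1) (at_left (1::real))"
    using eventually_at_left_real[of 0 "1::real"] by simp
  have intro: "(A, B) \<in> radial_limits C"
    if "\<And>r. 0 < r \<Longrightarrow> r < 1 \<Longrightarrow> (A, f r) \<in> C r" "(f \<longlongrightarrow> B) (at_left 1)" for A B f
    unfolding radial_limits_def using that by blast
  show "(0, 0) \<in> radial_limits C"
    by (rule intro[where f = "\<lambda>_. 0"]) (auto intro: contractive_hom_graph.zero C)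
  fix A B assume "(A, B) \<in> radial_limits C"
  then obtain f where f: "\<And>r. 0 < r \<Longrightarrow> r < 1 \<Longrightarrow> (A, f r) \<in> C r" "(f \<longlongrightarrow> B) (at_left 1)"
    by (auto simp: radial_limits_def)
  show "(c *\<^sub>C A, c *\<^sub>C B) \<in> radial_limits C" for c
    by (rule intro[where f = "\<lambda>r. c *\<^sub>C f r"])
      (auto intro: contractive_hom_graph.scale[OF C] f bounded_linear.tendsto[OF bounded_linear_scaleC])
  show "B \<in> cbounded"
    by (rule Lim_in_closed_set[OF closed_cbounded _ _ f(2)])
      (auto intro: eventually_mono[OF ev] contractive_hom_graph.cbounded[OF C] f(1))
  show "norm B \<le> norm A"
    by (rule tendsto_upperbound[OF tendsto_norm[OF f(2)]])
      (auto intro: eventually_mono[OF ev] contractive_hom_graph.contractive[OF C] f(1))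
  fix A' B' assume "(A', B') \<in> radial_limits C"
  then obtain f' where f': "\<And>r. 0 < r \<Longrightarrow> r < 1 \<Longrightarrow> (A', f' r) \<in> C r" "(f' \<longlongrightarrow> B') (at_left 1)"
    by (auto simp: radial_limits_def)
  show "(A + A', B + B') \<in> radial_limits C"
    by (rule intro[where f = "\<lambda>r. f r + f' r"])
      (auto intro: contractive_hom_graph.add[OF C] f f' tendsto_add)
  show "(A o\<^sub>L A', B o\<^sub>L B') \<in> radial_limits C"
    by (rule intro[where f = "\<lambda>r. f r o\<^sub>L f' r"])
      (auto intro: contractive_hom_graph.compose[OF C] f f'
        bounded_bilinear.tendsto[OF bounded_bilinear_blinfun_compose])
qed

section \<open>The contractive homomorphism\<close>

context stabilized_strict_row_contraction
begin

lemma contractive_hom_graph_exists: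
  fixes \<xi> :: "('v, 'e) word \<Rightarrow> 'k::chilbert_space"
  assumes basis: "orthonormal_basis (free_semigroupoid G) \<xi>"
  shows "\<exists>C. contractive_hom_graph C \<and> (\<forall>e\<in>arcs G. (creation G \<xi> e, S e) \<in> C) \<and>
    (\<forall>x\<in>verts G. (vertex_projection G \<xi> x, Q x) \<in> C)"
proof -
  obtain V :: "'k \<Rightarrow>\<^sub>L ('h \<Rightarrow>\<^sub>L 'h)" where V: "V \<in> cbounded"
    and V_sum: "\<And>k. ((\<lambda>w. cinner k (\<xi> w) *\<^sub>C word_op Q S w) has_sum V k) (free_semigroupoid G)"
    and V_basis: "\<And>w. w \<in> free_semigroupoid G \<Longrightarrow> V (\<xi> w) = word_op Q S w"
    using symbol_exists[OF basis] by blast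
  have "contractive_hom_graph (intertwined V)"
  proof
    show "(0, 0) \<in> intertwined V"
      by (auto simp: intertwined_def zero_in_cbounded intro!: blinfun_eqI)
    fix A B assume AB: "(A, B) \<in> intertwined V"
    then have A: "A \<in> cbounded" and B: "B \<in> cbounded" and BV: "\<And>k. B o\<^sub>L V k = V (A k)"
      by (auto simp: intertwined_def)
    have BV_apply: "B (V k h) = V (A k) h" for k h
      by (metis BV blinfun_apply_blinfun_compose)
    show "(c *\<^sub>C A, c *\<^sub>C B) \<in> intertwined V" for c
      using A B by (auto simp: intertwined_def cbounded_scaleC scaleC_blinfun.rep_eq BV_apply
          cbounded_apply[OF V] intro!: blinfun_eqI)
    show "B \<in> cbounded" by (rule B)
    show "norm B \<le> norm A"
      by (rule intertwined_contractive[OF basis V_sum V_basis AB])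
    fix A' B' assume "(A', B') \<in> intertwined V"
    then have A': "A' \<in> cbounded" and B': "B' \<in> cbounded" and BV': "\<And>k. B' o\<^sub>L V k = V (A' k)"
      by (auto simp: intertwined_def)
    have BV'_apply: "B' (V k h) = V (A' k) h" for k h
      by (metis BV' blinfun_apply_blinfun_compose)
    show "(A + A', B + B') \<in> intertwined V"
      using A B A' B' by (auto simp: intertwined_def cbounded_add blinfun.add_left blinfun.add_right
          BV_apply BV'_apply intro!: blinfun_eqI)
    show "(A o\<^sub>L A', B o\<^sub>L B') \<in> intertwined V"
      using A B A' B' by (auto simp: intertwined_def cbounded_compose BV_apply BV'_apply
          intro!: blinfun_eqI)
  qed
  then show ?thesis
    using creation_intertwined[OF basis V V_basis] vertex_projection_intertwined[OF basis V V_basis]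
    by blast
qed

end

lemma blinfun_compose_scaleR:
  "(r *\<^sub>R A) o\<^sub>L B = r *\<^sub>R (A o\<^sub>L B)" "A o\<^sub>L (r *\<^sub>R B) = r *\<^sub>R (A o\<^sub>L B)"
  by (auto intro!: blinfun_eqI simp: blinfun.scaleR_left blinfun.scaleR_right)

lemma stabilized_strict_row_contraction_scaled:
  fixes T :: "'e \<Rightarrow> 'h::chilbert_space \<Rightarrow>\<^sub>L 'h"
  assumes "wf_digraph G" and stab: "stabilizes G Q T"
    and T: "\<And>e. e \<in> arcs G \<Longrightarrow> T e \<in> cbounded"
    and S: "has_strong_sum (\<lambda>e. T e o\<^sub>L adj (T e)) S (arcs G)" "op_le S id_blinfun"
    and r: "0 < r" "r < 1"
  shows "stabilized_strict_row_contraction G (\<lambda>e. r *\<^sub>R T e) (r\<^sup>2 *\<^sub>R S) (r\<^sup>2) Q"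
proof -
  interpret wf_digraph G by fact
  have adj_r: "adj (r *\<^sub>R T e) = r *\<^sub>R adj (T e)" if "e \<in> arcs G" for e
    using adj_scaleC[OF T[OF that], of "complex_of_real r"] by (simp add: scaleR_scaleC)
  show ?thesis
  proof
    show "r *\<^sub>R T e \<in> cbounded" if "e \<in> arcs G" for e
      using cbounded_scaleC[OF T[OF that]] by (simp add: scaleR_scaleC)
    show "has_strong_sum (\<lambda>e. (r *\<^sub>R T e) o\<^sub>L adj (r *\<^sub>R T e)) (r\<^sup>2 *\<^sub>R S) (arcs G)"
      unfolding has_strong_sum_def
    proof
      fix x
      have "((\<lambda>e. r\<^sup>2 *\<^sub>R T e (adj (T e) x)) has_sum r\<^sup>2 *\<^sub>R S x) (arcs G)"
        using S(1) by (intro has_sum_bounded_linear[OF bounded_linear_scaleR_right])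
          (simp add: has_strong_sum_def)
      then show "((\<lambda>e. ((r *\<^sub>R T e) o\<^sub>L adj (r *\<^sub>R T e)) x) has_sum (r\<^sup>2 *\<^sub>R S) x) (arcs G)"
        by (subst has_sum_cong[where g = "\<lambda>e. r\<^sup>2 *\<^sub>R T e (adj (T e) x)"])
          (simp_all add: adj_r blinfun.scaleR_left blinfun.scaleR_right power2_eq_square)
    qed
    show "Re (cinner ((r\<^sup>2 *\<^sub>R S) x) x) \<le> r\<^sup>2 * (norm x)\<^sup>2" for x
    proof -
      have "0 \<le> Re (cinner ((id_blinfun - S) x) x)"
        using S(2) by (simp add: op_le_def)
      then have "inner (S x) x \<le> (norm x)\<^sup>2"
        by (simp add: Re_cinner blinfun.diff_left inner_diff_left power2_norm_eq_inner)
      then show ?thesis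
        by (simp add: Re_cinner blinfun.scaleR_left mult_left_mono)
    qed
    show "r\<^sup>2 < 1" using power_strict_mono[of r 1 2] r by simp
    show "stabilizes G Q (\<lambda>e. r *\<^sub>R T e)"
      using stab r by (auto simp: stabilizes_def blinfun_compose_scaleR)
  qed (use r in auto)
qed

theorem theorem6p1:
  fixes G :: "('v, 'e) pre_digraph"
    and \<xi> :: "('v, 'e) word \<Rightarrow> 'k::chilbert_space"
    and T :: "'e \<Rightarrow> 'h::chilbert_space \<Rightarrow>\<^sub>L 'h"
    and Q :: "'v \<Rightarrow> 'h \<Rightarrow>\<^sub>L 'h"
  assumes "wf_digraph G" and "countable (verts G)" and "countable (arcs G)" and "no_sinks G"
    and "orthonormal_basis (free_semigroupoid G) \<xi>"
    and "row_contraction (arcs G) T"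
    and "stabilizes G Q T"
  shows "\<exists>\<Psi> :: ('k \<Rightarrow>\<^sub>L 'k) \<Rightarrow> ('h \<Rightarrow>\<^sub>L 'h).
    algebra_hom (quiver_algebra G \<xi>) \<Psi> \<and>
    (\<forall>A\<in>quiver_algebra G \<xi>. norm (\<Psi> A) \<le> norm A) \<and>
    (\<forall>e\<in>arcs G. \<Psi> (creation G \<xi> e) = T e) \<and>
    (\<forall>x\<in>verts G. \<Psi> (vertex_projection G \<xi> x) = Q x)"
proof -
  obtain S where T: "\<And>e. e \<in> arcs G \<Longrightarrow> T e \<in> cbounded"
    and S: "has_strong_sum (\<lambda>e. T e o\<^sub>L adj (T e)) S (arcs G)" "op_le S id_blinfun"
    using assms(6) by (auto simp: row_contraction_def)
  have "\<exists>C. contractive_hom_graph C \<and> (\<forall>e\<in>arcs G. (creation G \<xi> e, r *\<^sub>R T e) \<in> C) \<and>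
      (\<forall>x\<in>verts G. (vertex_projection G \<xi> x, Q x) \<in> C)" if "0 < r" "r < 1" for r
    using stabilized_strict_row_contraction_scaled[OF assms(1,7) T S that] assms(5)
    by (rule stabilized_strict_row_contraction.contractive_hom_graph_exists)
  then obtain C where C: "\<And>r. 0 < r \<Longrightarrow> r < 1 \<Longrightarrow> contractive_hom_graph (C r)"
    and C_arcs: "\<And>r e. 0 < r \<Longrightarrow> r < 1 \<Longrightarrow> e \<in> arcs G \<Longrightarrow> (creation G \<xi> e, r *\<^sub>R T e) \<in> C r"
    and C_verts: "\<And>r x. 0 < r \<Longrightarrow> r < 1 \<Longrightarrow> x \<in> verts G \<Longrightarrow> (vertex_projection G \<xi> x, Q x) \<in> C r"
    by metis
  define P where "P = (\<lambda>e. (creation G \<xi> e, T e)) ` arcs G \<union>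
    (\<lambda>x. (vertex_projection G \<xi> x, Q x)) ` verts G"
  have "(creation G \<xi> e, T e) \<in> radial_limits C" if "e \<in> arcs G" for e
  proof -
    have "((\<lambda>r. r *\<^sub>R T e) \<longlongrightarrow> 1 *\<^sub>R T e) (at_left 1)"
      by (intro tendsto_intros)
    then show ?thesis
      unfolding radial_limits_def using C_arcs that by (auto intro!: exI[of _ "\<lambda>r. r *\<^sub>R T e"])
  qed
  moreover have "(vertex_projection G \<xi> x, Q x) \<in> radial_limits C" if "x \<in> verts G" for x
    unfolding radial_limits_def using C_verts that by (auto intro!: exI[of _ "\<lambda>_. Q x"])
  ultimately have "P \<subseteq> radial_limits C"
    by (auto simp: P_def)
  from contractive_hom_graph_extends_to_hull[OF contractive_hom_graph_radial_limits[OF C] this]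
  obtain \<Psi> where \<Psi>: "algebra_hom ((\<lambda>X. subalgebra X \<and> closed X) hull (fst ` P)) \<Psi>"
    "\<forall>A\<in>(\<lambda>X. subalgebra X \<and> closed X) hull (fst ` P). norm (\<Psi> A) \<le> norm A"
    and on_P: "\<forall>(A, B)\<in>P. \<Psi> A = B" by blast
  have "fst ` P = creation G \<xi> ` arcs G \<union> vertex_projection G \<xi> ` verts G"
    by (auto simp: P_def image_Un image_image)
  moreover have "\<Psi> (creation G \<xi> e) = T e" if "e \<in> arcs G" for e
    using bspec[OF on_P, of "(creation G \<xi> e, T e)"] that by (simp add: P_def)
  moreover have "\<Psi> (vertex_projection G \<xi> x) = Q x" if "x \<in> verts G" for x
    using bspec[OF on_P, of "(vertex_projection G \<xi> x, Q x)"] that by (simp add: P_def)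
  ultimately show ?thesis
    using \<Psi> by (auto simp: quiver_algebra_def)
qed

end
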